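(* Let $(\mathfrak{L},\cdot)$ be a (finite-dimensional, real) symmetric Leibniz algebra, let $(G,\rhd)$ be the associated Lie rack, with operation $h\rhd g=g^{-1}hg\,\chi(h,g)$, and let $$Q(G)=\{g\in G : \chi(g,g)=1\},$$ which is a quandle under $\rhd$. Then the quandle $Q(G)$ is quasi-trivial if and only if $$[g,k^{-1}gk]=1\quad\text{for any } g,k\in Q(G),$$ where $[a,b]=aba^{-1}b^{-1}$ denotes the group commutator in $G$.
   Context: **Symmetric Leibniz algebras.** An algebra $(\mathfrak{L},\cdot)$ (a vector space with a bilinear product) is a symmetric Leibniz algebra if $u\cdot(v\cdot w)=(u\cdot v)\cdot w+v\cdot(u\cdot w)$ and $(v\cdot w)\cdot u=(v\cdot u)\cdot w+v\cdot(w\cdot u)$ for all $u,v,w$. Write $[u,v]=\frac12(u\cdot v-v\cdot u)$ and $\omega(u,v)=\frac12(u\cdot v+v\cdot u)$. It is known that then $(\mathfrak{L},[\,,\,])$ is a Lie algebra, $\omega$ takes values in its center, and $\omega([u,v],w)=\omega(\omega(u,v),w)=0$ for all $u,v,w$. **Associated Lie rack.** Let $\mathfrak{L}\cdot\mathfrak{L}=\mathrm{span}\{u\cdot v\}$, $\mathfrak{a}=\mathfrak{L}/(\mathfrak{L}\cdot\mathfrak{L})$, $q:\mathfrak{L}\to\mathfrak{a}$ the quotient map, and $\beta:\mathfrak{a}\times\mathfrak{a}\to\mathfrak{L}$ the well-defined bilinear map $\beta(q(u),q(v))=\omega(u,v)$. Let $G$ be the connected simply connected Lie group with Lie algebra $(\mathfrak{L},[\,,\,])$,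 $\exp:\mathfrak{L}\to G$ its exponential map, and $\kappa:G\to\mathfrak{a}$ the Lie group homomorphism (to the additive group $\mathfrak{a}$) with $d_e\kappa=q$. Put $\chi(h,g)=\exp(\beta(\kappa(h),\kappa(g)))$ and $h\rhd g=g^{-1}hg\,\chi(h,g)$. Then $(G,\rhd)$ is a Lie rack, called the Lie rack associated to $(\mathfrak{L},\cdot)$, and $Q(G)$ is the set of its idempotents ($g\rhd g=g$). **Quandles.** A rack is a non-empty set $X$ with an operation $\rhd$ such that each $\mathrm{R}_x:y\mapsto y\rhd x$ is a bijection of $X$ and $(x\rhd y)\rhd z=(x\rhd z)\rhd(y\rhd z)$ for all $x,y,z$; a quandle is a rack with $x\rhd x=x$ for all $x$. For a quandle $Q$, $\mathrm{Inn}(Q)$ is the group generated by the bijections $\mathrm{R}_x$, $x\in Q$. The quandle $Q$ is quasi-trivial if $x\rhd\varphi(x)=x$ for all $x\in Q$ and $\varphi\in\mathrm{Inn}(Q)$. *)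

theory Defs
  imports "HOL-Analysis.Analysis" "HOL-Algebra.Bij" "HOL-Algebra.Generated_Groups"
begin

section \<open>Symmetric Leibniz algebras\<close>

definition symmetric_leibniz_algebra :: "('l::real_vector \<Rightarrow> 'l \<Rightarrow> 'l) \<Rightarrow> bool" where
  "symmetric_leibniz_algebra m \<longleftrightarrow> bilinear m
     \<and> (\<forall>u v w. m u (m v w) = m (m u v) w + m v (m u w))
     \<and> (\<forall>u v w. m (m v w) u = m (m v u) w + m v (m w u))"

definition leibniz_bracket :: "('l::real_vector \<Rightarrow> 'l \<Rightarrow> 'l) \<Rightarrow> 'l \<Rightarrow> 'l \<Rightarrow> 'l" where
  "leibniz_bracket m u v = (1/2) *\<^sub>R (m u v - m v u)"

definition leibniz_omega :: "('l::real_vector \<Rightarrow> 'l \<Rightarrow> 'l) \<Rightarrow> 'l \<Rightarrow> 'l \<Rightarrow> 'l" where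
  "leibniz_omega m u v = (1/2) *\<^sub>R (m u v + m v u)"

definition finite_dimensional_UNIV :: "'l::real_vector itself \<Rightarrow> bool" where
  "finite_dimensional_UNIV _ \<longleftrightarrow> (\<exists>B::'l set. finite B \<and> span B = UNIV)"

text \<open>The quotient space is given up to isomorphism, as any surjective linear
  map whose kernel is the span of all products.\<close>

definition product_quotient_map ::
    "('l::real_vector \<Rightarrow> 'l \<Rightarrow> 'l) \<Rightarrow> ('l \<Rightarrow> 'a::real_vector) \<Rightarrow> bool" where
  "product_quotient_map m q \<longleftrightarrow>
     linear q \<and> surj q \<and> {u. q u = 0} = span {m u v | u v. True}"

text \<open>Here \<open>inv_into UNIV q\<close> picks a representative; for a symmetric Leibniz algebra the value
  does not depend on it, so that \<open>\<beta> (q u) (q v) = \<omega> u v\<close>.\<close>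

definition leibniz_beta ::
    "('l::real_vector \<Rightarrow> 'l \<Rightarrow> 'l) \<Rightarrow> ('l \<Rightarrow> 'a) \<Rightarrow> 'a \<Rightarrow> 'a \<Rightarrow> 'l" where
  "leibniz_beta m q x y = leibniz_omega m (inv_into UNIV q x) (inv_into UNIV q y)"


section \<open>Smooth manifolds\<close>

text \<open>\<open>C\<^sup>k\<close> maps on open subsets of finite-dimensional normed spaces. (Continuity of all
  iterated directional derivatives would be too weak in infinite dimension.)\<close>

primrec Ck_on :: "nat \<Rightarrow> 'e::real_normed_vector set \<Rightarrow> ('e \<Rightarrow> 'f::real_normed_vector) \<Rightarrow> bool" where
  "Ck_on 0 S f \<longleftrightarrow> continuous_on S f"
| "Ck_on (Suc k) S f \<longleftrightarrow> (\<forall>x\<in>S. f differentiable (at x))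
     \<and> (\<forall>v. Ck_on k S (\<lambda>x. frechet_derivative f (at x) v))"

definition smooth_on :: "'e::real_normed_vector set \<Rightarrow> ('e \<Rightarrow> 'f::real_normed_vector) \<Rightarrow> bool" where
  "smooth_on S f \<longleftrightarrow> (\<forall>k. Ck_on k S f)"

type_synonym ('m, 'e) chart = "'m set \<times> ('m \<Rightarrow> 'e)"

definition is_chart :: "('m::topological_space, 'e::real_normed_vector) chart \<Rightarrow> bool" where
  "is_chart c \<longleftrightarrow> (case c of (U, \<phi>) \<Rightarrow>
     open U \<and> open (\<phi> ` U) \<and> homeomorphism U (\<phi> ` U) \<phi> (inv_into U \<phi>))"

definition smooth_atlas :: "('m::topological_space, 'e::real_normed_vector) chart set \<Rightarrow> bool" where
  "smooth_atlas A \<longleftrightarrow> (\<forall>c\<in>A. is_chart c) \<and> (\<Union>c\<in>A. fst c) = UNIV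
     \<and> (\<forall>(U, \<phi>)\<in>A. \<forall>(V, \<psi>)\<in>A. smooth_on (\<phi> ` (U \<inter> V)) (\<psi> \<circ> inv_into U \<phi>))"

definition vector_atlas :: "('e::real_normed_vector, 'e) chart set" where
  "vector_atlas = {(UNIV, id)}"

definition prod_atlas ::
    "('m, 'e) chart set \<Rightarrow> ('n, 'f) chart set \<Rightarrow> ('m \<times> 'n, 'e \<times> 'f) chart set" where
  "prod_atlas A B = {(U \<times> V, map_prod \<phi> \<psi>) | U \<phi> V \<psi>. (U, \<phi>) \<in> A \<and> (V, \<psi>) \<in> B}"

text \<open>To be used for open sets \<open>S\<close>.\<close>

definition smooth_map_on ::
    "('m::topological_space, 'e::real_normed_vector) chart set
     \<Rightarrow> ('n::topological_space, 'f::real_normed_vector) chart set \<Rightarrow> 'm set \<Rightarrow> ('m \<Rightarrow> 'n) \<Rightarrow> bool" where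
  "smooth_map_on A B S F \<longleftrightarrow> continuous_on S F
     \<and> (\<forall>(U, \<phi>)\<in>A. \<forall>(V, \<psi>)\<in>B.
          smooth_on (\<phi> ` (U \<inter> S \<inter> F -` V)) (\<psi> \<circ> F \<circ> inv_into U \<phi>))"

definition smooth_near ::
    "('m::topological_space, 'e::real_normed_vector) chart set \<Rightarrow> 'm \<Rightarrow> ('m \<Rightarrow> real) \<Rightarrow> bool" where
  "smooth_near A p f \<longleftrightarrow> (\<exists>S. open S \<and> p \<in> S \<and> smooth_map_on A vector_atlas S f)"

text \<open>Tangent vectors at \<open>p\<close> are the derivations at \<open>p\<close> of the functions that are smooth near
  \<open>p\<close>; the value \<open>0\<close> on all other functions is a convention. Locality is automatic, since
  indicator functions of neighbourhoods of \<open>p\<close> are smooth near \<open>p\<close>.\<close>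

definition tangent_space ::
    "('m::topological_space, 'e::real_normed_vector) chart set \<Rightarrow> 'm \<Rightarrow> (('m \<Rightarrow> real) \<Rightarrow> real) set" where
  "tangent_space A p = {v.
     (\<forall>f. \<not> smooth_near A p f \<longrightarrow> v f = 0)
     \<and> (\<forall>f g a b. smooth_near A p f \<longrightarrow> smooth_near A p g \<longrightarrow>
          v (\<lambda>x. a * f x + b * g x) = a * v f + b * v g)
     \<and> (\<forall>f g. smooth_near A p f \<longrightarrow> smooth_near A p g \<longrightarrow>
          v (\<lambda>x. f x * g x) = f p * v g + g p * v f)}"

text \<open>The tangent vector at the point \<open>x\<close> of a vector space corresponding to the vector \<open>w\<close>.\<close>

definition vector_tangent :: "'e::real_normed_vector \<Rightarrow> 'e \<Rightarrow> ('e \<Rightarrow> real) \<Rightarrow> real" where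
  "vector_tangent x w =
     (\<lambda>f. if smooth_near vector_atlas x f then frechet_derivative f (at x) w else 0)"

text \<open>The differential at \<open>p\<close> of a smooth map \<open>F\<close> into the manifold with atlas \<open>B\<close>.\<close>

definition differential ::
    "('n::topological_space, 'f::real_normed_vector) chart set \<Rightarrow> ('m \<Rightarrow> 'n) \<Rightarrow> 'm
     \<Rightarrow> (('m \<Rightarrow> real) \<Rightarrow> real) \<Rightarrow> ('n \<Rightarrow> real) \<Rightarrow> real" where
  "differential B F p v = (\<lambda>f. if smooth_near B (F p) f then v (f \<circ> F) else 0)"


section \<open>Lie groups\<close>

definition lie_group ::
    "'g::{t2_space,second_countable_topology} monoid \<Rightarrow> ('g, 'e::real_normed_vector) chart set \<Rightarrow> bool" where
  "lie_group G A \<longleftrightarrow> group G \<and> carrier G = UNIV \<and> smooth_atlas A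
     \<and> smooth_map_on (prod_atlas A A) A UNIV (\<lambda>(x, y). x \<otimes>\<^bsub>G\<^esub> y)
     \<and> smooth_map_on A A UNIV (\<lambda>x. inv\<^bsub>G\<^esub> x)"

text \<open>The left-invariant vector field extending \<open>v\<close> (a tangent vector at the identity), and the
  Lie bracket at the identity of two such vector fields.\<close>

definition left_invariant_field ::
    "'g monoid \<Rightarrow> (('g \<Rightarrow> real) \<Rightarrow> real) \<Rightarrow> 'g \<Rightarrow> ('g \<Rightarrow> real) \<Rightarrow> real" where
  "left_invariant_field G v p f = v (\<lambda>x. f (p \<otimes>\<^bsub>G\<^esub> x))"

definition tangent_bracket ::
    "'g::topological_space monoid \<Rightarrow> ('g, 'e::real_normed_vector) chart set
     \<Rightarrow> (('g \<Rightarrow> real) \<Rightarrow> real) \<Rightarrow> (('g \<Rightarrow> real) \<Rightarrow> real) \<Rightarrow> ('g \<Rightarrow> real) \<Rightarrow> real" where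
  "tangent_bracket G A v w =
     (\<lambda>f. if smooth_near A \<one>\<^bsub>G\<^esub> f
          then v (\<lambda>p. left_invariant_field G w p f) - w (\<lambda>p. left_invariant_field G v p f)
          else 0)"

text \<open>\<open>\<iota>\<close> identifies the Lie algebra with bracket \<open>br\<close> with the Lie algebra of the Lie group.\<close>

definition lie_algebra_identification ::
    "'g::topological_space monoid \<Rightarrow> ('g, 'e::real_normed_vector) chart set
     \<Rightarrow> ('l::real_vector \<Rightarrow> 'l \<Rightarrow> 'l) \<Rightarrow> ('l \<Rightarrow> ('g \<Rightarrow> real) \<Rightarrow> real) \<Rightarrow> bool" where
  "lie_algebra_identification G A br \<iota> \<longleftrightarrow>
     bij_betw \<iota> UNIV (tangent_space A \<one>\<^bsub>G\<^esub>)
     \<and> (\<forall>f. linear (\<lambda>u. \<iota> u f))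
     \<and> (\<forall>u v. \<iota> (br u v) = tangent_bracket G A (\<iota> u) (\<iota> v))"

definition one_parameter_subgroup ::
    "'g::topological_space monoid \<Rightarrow> ('g, 'e::real_normed_vector) chart set \<Rightarrow> (real \<Rightarrow> 'g) \<Rightarrow> bool" where
  "one_parameter_subgroup G A \<gamma> \<longleftrightarrow>
     smooth_map_on vector_atlas A UNIV \<gamma> \<and> (\<forall>s t. \<gamma> (s + t) = \<gamma> s \<otimes>\<^bsub>G\<^esub> \<gamma> t)"

definition exponential_map ::
    "'g::topological_space monoid \<Rightarrow> ('g, 'e::real_normed_vector) chart set
     \<Rightarrow> ('l \<Rightarrow> ('g \<Rightarrow> real) \<Rightarrow> real) \<Rightarrow> ('l \<Rightarrow> 'g) \<Rightarrow> bool" where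
  "exponential_map G A \<iota> E \<longleftrightarrow>
     (\<forall>u. \<exists>\<gamma>. one_parameter_subgroup G A \<gamma>
        \<and> differential A \<gamma> 0 (vector_tangent 0 1) = \<iota> u \<and> E u = \<gamma> 1)"

text \<open>Lie group homomorphisms into the additive group of a vector space, with prescribed
  differential at the identity.\<close>

definition additive_hom_with_differential ::
    "'g::topological_space monoid \<Rightarrow> ('g, 'e::real_normed_vector) chart set
     \<Rightarrow> ('l \<Rightarrow> ('g \<Rightarrow> real) \<Rightarrow> real) \<Rightarrow> ('l \<Rightarrow> 'a::real_normed_vector) \<Rightarrow> ('g \<Rightarrow> 'a) \<Rightarrow> bool" where
  "additive_hom_with_differential G A \<iota> q \<kappa> \<longleftrightarrow>
     smooth_map_on A vector_atlas UNIV \<kappa>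
     \<and> (\<forall>x y. \<kappa> (x \<otimes>\<^bsub>G\<^esub> y) = \<kappa> x + \<kappa> y)
     \<and> (\<forall>u. differential vector_atlas \<kappa> \<one>\<^bsub>G\<^esub> (\<iota> u) = vector_tangent 0 (q u))"

definition group_commutator :: "'g monoid \<Rightarrow> 'g \<Rightarrow> 'g \<Rightarrow> 'g" where
  "group_commutator G a b = a \<otimes>\<^bsub>G\<^esub> b \<otimes>\<^bsub>G\<^esub> inv\<^bsub>G\<^esub> a \<otimes>\<^bsub>G\<^esub> inv\<^bsub>G\<^esub> b"


section \<open>The associated Lie rack\<close>

definition lie_rack_chi ::
    "('l::real_vector \<Rightarrow> 'l \<Rightarrow> 'l) \<Rightarrow> ('l \<Rightarrow> 'a) \<Rightarrow> ('l \<Rightarrow> 'g) \<Rightarrow> ('g \<Rightarrow> 'a) \<Rightarrow> 'g \<Rightarrow> 'g \<Rightarrow> 'g" where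
  "lie_rack_chi m q E \<kappa> h g = E (leibniz_beta m q (\<kappa> h) (\<kappa> g))"

definition lie_rack_op :: "'g monoid \<Rightarrow> ('g \<Rightarrow> 'g \<Rightarrow> 'g) \<Rightarrow> 'g \<Rightarrow> 'g \<Rightarrow> 'g" where
  "lie_rack_op G chi h g = inv\<^bsub>G\<^esub> g \<otimes>\<^bsub>G\<^esub> h \<otimes>\<^bsub>G\<^esub> g \<otimes>\<^bsub>G\<^esub> chi h g"

definition lie_rack_Q :: "'g monoid \<Rightarrow> ('g \<Rightarrow> 'g \<Rightarrow> 'g) \<Rightarrow> 'g set" where
  "lie_rack_Q G chi = {g \<in> carrier G. chi g g = \<one>\<^bsub>G\<^esub>}"


section \<open>Racks and quandles\<close>

definition rack :: "'x set \<Rightarrow> ('x \<Rightarrow> 'x \<Rightarrow> 'x) \<Rightarrow> bool" where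
  "rack X r \<longleftrightarrow> X \<noteq> {} \<and> (\<forall>x\<in>X. bij_betw (\<lambda>y. r y x) X X)
     \<and> (\<forall>x\<in>X. \<forall>y\<in>X. \<forall>z\<in>X. r (r x y) z = r (r x z) (r y z))"

definition quandle :: "'x set \<Rightarrow> ('x \<Rightarrow> 'x \<Rightarrow> 'x) \<Rightarrow> bool" where
  "quandle X r \<longleftrightarrow> rack X r \<and> (\<forall>x\<in>X. r x x = x)"

definition Inn :: "'x set \<Rightarrow> ('x \<Rightarrow> 'x \<Rightarrow> 'x) \<Rightarrow> ('x \<Rightarrow> 'x) set" where
  "Inn X r = generate (BijGroup X) ((\<lambda>x. \<lambda>y\<in>X. r y x) ` X)"

definition quasi_trivial :: "'x set \<Rightarrow> ('x \<Rightarrow> 'x \<Rightarrow> 'x) \<Rightarrow> bool" where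
  "quasi_trivial X r \<longleftrightarrow> (\<forall>x\<in>X. \<forall>\<phi>\<in>Inn X r. r x (\<phi> x) = x)"

end

theory Submission
  imports Defs
begin

text \<open>
  For \<open>z\<close> in the image of \<open>\<omega>\<close>, \<open>exp z\<close> is central in \<open>G\<close> and lies in the kernel of \<open>\<kappa>\<close>, so
  membership in \<open>Q\<close> depends on \<open>\<kappa>\<close> only and every inner automorphism of \<open>Q\<close> is, up to central
  factors, conjugation by an element of the subgroup generated by \<open>Q\<close>.
  Quasi-triviality therefore says that \<open>g\<close> commutes with \<open>a\<inverse>ga\<close> for all \<open>g\<close> in \<open>Q\<close> and all such
  \<open>a\<close>, whereas the commutator condition says this for \<open>a\<close> in \<open>Q\<close> only. The step from \<open>a\<close> to
  \<open>ab\<close> works because \<open>c = g\<inverse>(a\<inverse>ga)\<close> has \<open>\<kappa>(c) = 0\<close>, so that \<open>bc\<close> is again in \<open>Q\<close> and the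
  condition may be applied to the pair \<open>bc\<close>, \<open>g\<close>.

  Centrality of \<open>exp z\<close>, for \<open>z\<close> in the center of the Lie algebra, is obtained without flows:
  \<open>Ad (exp tz)\<close> is constant in \<open>t\<close> since its derivative is the bracket with \<open>z\<close>, hence
  \<open>p \<mapsto> exp(tz) p exp(-tz) p\<inverse>\<close> has derivative zero near the identity and is constant there,
  and a neighbourhood of the identity generates the connected group \<open>G\<close>.
\<close>

section \<open>Racks twisted by a central map\<close>

text \<open>The reduction to \<open>bc\<close> succeeds because the condition is an Engel identity:
  it makes \<open>e = inv b inv g b g\<close> commute with \<open>g\<close> and \<open>b\<close>,
  and its instance for \<open>bc\<close> makes \<open>e\<close> commute with \<open>c\<close>. Up to
  conjugation by \<open>b\<close>, everything then happens among the commuting elements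
  \<open>g\<close>, \<open>c\<close>, \<open>e\<close>. On the analytic side, tangent vectors are
  derivations and the bracket is given by left-invariant fields, while differentiating
  \<open>Ad\<close> requires formulas. Everything is therefore carried to one chart at the identity.
  There the multiplication is a smooth map \<open>M\<close>, and the bracket of two vectors, tested
  on coordinate functions, is the difference of two mixed second derivatives of \<open>M\<close>.
  Smoothness is expressed by derivatives in fixed directions; whenever the direction itself varies
  (chain rule, derivative of \<open>Ad\<close>), it is expanded in a finite orthogonal basis. The
  exponential is specified by the existence of a one-parameter subgroup with the right derivative,
  so even \<open>exp 0 = 1\<close> calls for a uniqueness argument.\<close>

context group
begin

section \<open>Commuting conjugates in a group\<close>

lemma commute_mult:
  assumes "x \<otimes> y = y \<otimes> x" "x \<otimes> z = z \<otimes> x" "x \<in> carrier G" "y \<in> carrier G" "z \<in> carrier G"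
  shows "x \<otimes> (y \<otimes> z) = (y \<otimes> z) \<otimes> x"
  using assms by (metis m_assoc m_closed)

lemma commute_inv:
  assumes "x \<otimes> y = y \<otimes> x" "x \<in> carrier G" "y \<in> carrier G"
  shows "x \<otimes> inv y = inv y \<otimes> x"
  using assms by (metis inv_closed inv_solve_left inv_solve_right m_assoc m_closed)

lemma mult_inv_cancel:
  assumes "x \<in> carrier G" "y \<in> carrier G"
  shows "x \<otimes> (inv x \<otimes> y) = y" "inv x \<otimes> (x \<otimes> y) = y"
  using assms by (simp_all add: m_assoc[symmetric])

lemma commute_conj:
  assumes "x \<otimes> y = y \<otimes> x" "x \<in> carrier G" "y \<in> carrier G" "b \<in> carrier G"
  shows "(inv b \<otimes> x \<otimes> b) \<otimes> (inv b \<otimes> y \<otimes> b) = (inv b \<otimes> y \<otimes> b) \<otimes> (inv b \<otimes> x \<otimes> b)"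
proof -
  have "(inv b \<otimes> u \<otimes> b) \<otimes> (inv b \<otimes> v \<otimes> b) = inv b \<otimes> (u \<otimes> v) \<otimes> b"
    if "u \<in> carrier G" "v \<in> carrier G" for u v
    using that assms(4) mult_inv_cancel by (simp add: m_assoc)
  with assms show ?thesis by simp
qed

text \<open>The hypotheses on \<open>b\<close> and \<open>b \<otimes> c\<close> are Engel conditions; polarizing them shows
  that \<open>c\<close> commutes with \<open>inv b \<otimes> inv g \<otimes> b \<otimes> g\<close>.\<close>

lemma conjugates_commute_step:
  assumes car: "g \<in> carrier G" "a \<in> carrier G" "b \<in> carrier G"
    and c_def: "c = inv g \<otimes> (inv a \<otimes> g \<otimes> a)"
    and ga: "g \<otimes> (inv a \<otimes> g \<otimes> a) = (inv a \<otimes> g \<otimes> a) \<otimes> g"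
    and gb: "g \<otimes> (inv b \<otimes> g \<otimes> b) = (inv b \<otimes> g \<otimes> b) \<otimes> g"
    and bg: "b \<otimes> (inv g \<otimes> b \<otimes> g) = (inv g \<otimes> b \<otimes> g) \<otimes> b"
    and bcg: "(b \<otimes> c) \<otimes> (inv g \<otimes> (b \<otimes> c) \<otimes> g) = (inv g \<otimes> (b \<otimes> c) \<otimes> g) \<otimes> (b \<otimes> c)"
  shows "g \<otimes> (inv (a \<otimes> b) \<otimes> g \<otimes> (a \<otimes> b)) = (inv (a \<otimes> b) \<otimes> g \<otimes> (a \<otimes> b)) \<otimes> g"
    and "g \<otimes> (inv (a \<otimes> inv b) \<otimes> g \<otimes> (a \<otimes> inv b)) = (inv (a \<otimes> inv b) \<otimes> g \<otimes> (a \<otimes> inv b)) \<otimes> g"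
proof -
  note simps = m_assoc inv_mult_group mult_inv_cancel
  define e where "e = inv b \<otimes> (inv g \<otimes> b \<otimes> g)"
  have c: "c \<in> carrier G" and e: "e \<in> carrier G" using car by (auto simp: c_def e_def)
  have gc: "g \<otimes> c = c \<otimes> g"
    unfolding c_def using car by (intro commute_mult[OF commute_inv[OF refl] ga]) auto
  have be: "b \<otimes> e = e \<otimes> b"
    unfolding e_def using car by (intro commute_mult[OF commute_inv[OF refl] bg]) auto
  have gbe: "inv b \<otimes> g \<otimes> b = g \<otimes> inv e"
    using car by (simp add: e_def simps)
  have ginv: "g \<otimes> inv e = inv e \<otimes> g"
  proof -
    have "inv e = inv g \<otimes> (inv b \<otimes> g \<otimes> b)" using car e by (simp add: gbe simps)
    then show ?thesis using gb car by (metis commute_mult commute_inv inv_closed m_closed)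
  qed
  then have ge: "g \<otimes> e = e \<otimes> g" using commute_inv[of g "inv e"] car e by simp
  \<comment> \<open>As \<open>c\<close> commutes with \<open>g\<close>, conjugating
    \<open>b \<otimes> c\<close> by \<open>g\<close> affects only \<open>b\<close>; the condition on
    \<open>b \<otimes> c\<close> thus becomes one on
    \<open>inv c \<otimes> e \<otimes> c\<close>.\<close>
  have conj_bc: "inv g \<otimes> (b \<otimes> c) \<otimes> g = (inv g \<otimes> b \<otimes> g) \<otimes> c"
    using car c gc by (simp add: m_assoc)
  have "(b \<otimes> c) \<otimes> (inv (b \<otimes> c) \<otimes> ((inv g \<otimes> b \<otimes> g) \<otimes> c)) = (inv (b \<otimes> c) \<otimes> ((inv g \<otimes> b \<otimes> g) \<otimes> c)) \<otimes> (b \<otimes> c)"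
    using bcg[unfolded conj_bc] car c by (intro commute_mult[OF commute_inv[OF refl]]) auto
  moreover have "inv (b \<otimes> c) \<otimes> ((inv g \<otimes> b \<otimes> g) \<otimes> c) = inv c \<otimes> e \<otimes> c"
    using car c by (simp add: e_def simps)
  ultimately have "(b \<otimes> c) \<otimes> (inv c \<otimes> e \<otimes> c) = (inv c \<otimes> e \<otimes> c) \<otimes> (b \<otimes> c)" by simp
  \<comment> \<open>The conjugation \<open>x\<close> to \<open>c x inv c\<close> turns
    \<open>b \<otimes> c\<close> into \<open>c \<otimes> b\<close> and
    \<open>inv c \<otimes> e \<otimes> c\<close> into \<open>e\<close>. Since \<open>e\<close>
    commutes with \<open>b\<close>, it then commutes with \<open>c\<close>.\<close>
  from commute_conj[OF this, of "inv c"]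
  have "e \<otimes> (c \<otimes> b) = (c \<otimes> b) \<otimes> e" using car c e by (simp add: simps)
  moreover have "e \<otimes> inv b = inv b \<otimes> e" using be car e by (metis commute_inv)
  ultimately have "e \<otimes> ((c \<otimes> b) \<otimes> inv b) = ((c \<otimes> b) \<otimes> inv b) \<otimes> e"
    using car c e by (intro commute_mult[of e "c \<otimes> b" "inv b"]) auto
  then have ec: "e \<otimes> c = c \<otimes> e" using car c by (simp add: m_assoc)
  have gac: "inv a \<otimes> g \<otimes> a = g \<otimes> c" using car by (simp add: c_def simps)
  have gcg: "(g \<otimes> c) \<otimes> g = g \<otimes> (g \<otimes> c)" using gc car c by (simp add: m_assoc[symmetric])
  have gce: "(g \<otimes> c) \<otimes> e = e \<otimes> (g \<otimes> c)"
    using commute_mult[of e g c] ge ec car c e by simp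
  have A: "(g \<otimes> c) \<otimes> (g \<otimes> e) = (g \<otimes> e) \<otimes> (g \<otimes> c)"
    using car c e by (intro commute_mult[OF gcg gce]) auto
  have B: "(g \<otimes> c) \<otimes> (g \<otimes> inv e) = (g \<otimes> inv e) \<otimes> (g \<otimes> c)"
    using car c e by (intro commute_mult[OF gcg commute_inv[OF gce]]) auto
  \<comment> \<open>The two factors of \<open>e\<close> commute, so \<open>g \<otimes> e\<close>
    equals \<open>b g inv b\<close>. This exhibits \<open>g\<close> itself as a conjugate by
    \<open>b\<close> of a member of the commuting family, ready for
    \<open>commute_conj\<close>.\<close>
  have "e = (inv g \<otimes> b \<otimes> g) \<otimes> inv b"
    using bg car unfolding e_def by (metis commute_inv inv_closed m_closed)
  then have ge': "inv b \<otimes> (g \<otimes> e) \<otimes> b = g" using car by (simp add: simps)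
  show "g \<otimes> (inv (a \<otimes> b) \<otimes> g \<otimes> (a \<otimes> b)) = (inv (a \<otimes> b) \<otimes> g \<otimes> (a \<otimes> b)) \<otimes> g"
  proof -
    have "inv (a \<otimes> b) \<otimes> g \<otimes> (a \<otimes> b) = inv b \<otimes> (g \<otimes> c) \<otimes> b"
      unfolding gac[symmetric] using car by (simp add: simps)
    then show ?thesis using commute_conj[OF A, of b] ge' car c e by simp
  qed
  have "b \<otimes> (g \<otimes> inv e) \<otimes> inv b = g" unfolding gbe[symmetric] using car by (simp add: simps)
  moreover have "inv (a \<otimes> inv b) \<otimes> g \<otimes> (a \<otimes> inv b) = b \<otimes> (g \<otimes> c) \<otimes> inv b"
      unfolding gac[symmetric] using car by (simp add: simps)
  ultimately show "g \<otimes> (inv (a \<otimes> inv b) \<otimes> g \<otimes> (a \<otimes> inv b)) = (inv (a \<otimes> inv b) \<otimes> g \<otimes> (a \<otimes> inv b)) \<otimes> g"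
    using commute_conj[OF B, of "inv b"] car c e by simp
qed

end

section \<open>The conjugation quandle with a central twist\<close>

text \<open>\<open>F s t\<close> stands for the exponential of \<open>\<beta>(s,t)\<close>; the
  assumptions are all that the equivalence takes from the Lie group. \<open>kappa_F\<close> reflects
  that \<open>\<omega>\<close> takes values in the span of the products, and \<open>F_zero\<close>
  puts \<open>\<one>\<close> into \<open>Q\<close>.\<close>

locale central_twist = group G for G :: "'a monoid" (structure) +
  fixes \<kappa> :: "'a \<Rightarrow> 'b::ab_group_add" and F :: "'b \<Rightarrow> 'b \<Rightarrow> 'a"
  assumes kappa_mult: "\<lbrakk>x \<in> carrier G; y \<in> carrier G\<rbrakk> \<Longrightarrow> \<kappa> (x \<otimes> y) = \<kappa> x + \<kappa> y"
    and F_closed [simp]: "F s t \<in> carrier G"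
    and F_central: "x \<in> carrier G \<Longrightarrow> F s t \<otimes> x = x \<otimes> F s t"
    and kappa_F [simp]: "\<kappa> (F s t) = 0"
    and F_zero [simp]: "F 0 0 = \<one>"
begin

definition op (infixl "\<rhd>" 70) where "op = lie_rack_op G (\<lambda>h g. F (\<kappa> h) (\<kappa> g))"
definition Q where "Q = lie_rack_Q G (\<lambda>h g. F (\<kappa> h) (\<kappa> g))"

lemma op_eq: "h \<rhd> g = inv g \<otimes> h \<otimes> g \<otimes> F (\<kappa> h) (\<kappa> g)"
  by (simp add: op_def lie_rack_op_def)

lemma Q_iff: "g \<in> Q \<longleftrightarrow> g \<in> carrier G \<and> F (\<kappa> g) (\<kappa> g) = \<one>"
  by (simp add: Q_def lie_rack_Q_def)

lemma Q_carrier [simp]: "g \<in> Q \<Longrightarrow> g \<in> carrier G"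
  by (simp add: Q_iff)

lemma kappa_one [simp]: "\<kappa> \<one> = 0"
  using kappa_F[of 0 0] by (simp del: kappa_F)

lemma kappa_inv: "x \<in> carrier G \<Longrightarrow> \<kappa> (inv x) = - \<kappa> x"
  using kappa_mult[of "inv x" x] by (simp add: eq_neg_iff_add_eq_0)

lemma op_closed [simp]: "\<lbrakk>h \<in> carrier G; g \<in> carrier G\<rbrakk> \<Longrightarrow> h \<rhd> g \<in> carrier G"
  by (simp add: op_eq)

lemma kappa_op [simp]: "\<lbrakk>h \<in> carrier G; g \<in> carrier G\<rbrakk> \<Longrightarrow> \<kappa> (h \<rhd> g) = \<kappa> h"
  by (simp add: op_eq kappa_mult kappa_inv)

lemma Q_if_kappa_eq: "\<lbrakk>g \<in> Q; h \<in> carrier G; \<kappa> h = \<kappa> g\<rbrakk> \<Longrightarrow> h \<in> Q"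
  by (simp add: Q_iff)

lemma op_idem: "g \<in> Q \<Longrightarrow> g \<rhd> g = g"
  by (simp add: op_eq Q_iff)

lemma op_bij: assumes k: "k \<in> Q" shows "bij_betw (\<lambda>y. y \<rhd> k) Q Q"
\<comment> \<open>Since \<open>\<kappa> (y \<rhd> k) = \<kappa> y\<close>, the twist factor can be
  computed from the result; the inverse divides it out and then undoes the conjugation.\<close>
proof (rule bij_betw_byWitness[where f' = "\<lambda>y. k \<otimes> (y \<otimes> inv (F (\<kappa> y) (\<kappa> k))) \<otimes> inv k"])
  have k': "k \<in> carrier G" using k by simp
  show "\<forall>y\<in>Q. k \<otimes> ((y \<rhd> k) \<otimes> inv (F (\<kappa> (y \<rhd> k)) (\<kappa> k))) \<otimes> inv k = y"
    using k' by (simp add: op_eq[of _ k] kappa_mult kappa_inv m_assoc mult_inv_cancel)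
  have kap: "\<kappa> (k \<otimes> (y \<otimes> inv (F (\<kappa> y) (\<kappa> k))) \<otimes> inv k) = \<kappa> y" if "y \<in> Q" for y
    using that k' by (simp add: kappa_mult kappa_inv)
  show "\<forall>y\<in>Q. (k \<otimes> (y \<otimes> inv (F (\<kappa> y) (\<kappa> k))) \<otimes> inv k) \<rhd> k = y"
    using k' kap by (simp add: op_eq m_assoc mult_inv_cancel)
  show "(\<lambda>y. y \<rhd> k) ` Q \<subseteq> Q" using k by (auto intro: Q_if_kappa_eq)
  show "(\<lambda>y. k \<otimes> (y \<otimes> inv (F (\<kappa> y) (\<kappa> k))) \<otimes> inv k) ` Q \<subseteq> Q"
    using k' kap by (auto intro: Q_if_kappa_eq)
qed

text \<open>The operation leaves \<open>\<kappa>\<close> of its left argument unchanged, so both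
  sides carry the twists \<open>f\<close> and \<open>g\<close>, while \<open>h\<close> sits inside a
  conjugating element and cancels there by centrality.\<close>

lemma op_self_distrib:
  assumes x: "x \<in> carrier G" and y: "y \<in> carrier G" and z: "z \<in> carrier G"
  shows "(x \<rhd> y) \<rhd> z = (x \<rhd> z) \<rhd> (y \<rhd> z)"
proof -
  define f g h where "f = F (\<kappa> x) (\<kappa> y)" and "g = F (\<kappa> x) (\<kappa> z)" and "h = F (\<kappa> y) (\<kappa> z)"
  have car: "f \<in> carrier G" "g \<in> carrier G" "h \<in> carrier G" by (simp_all add: f_def g_def h_def)
  have cen: "f \<otimes> u = u \<otimes> f" "g \<otimes> u = u \<otimes> g" "h \<otimes> u = u \<otimes> h" if "u \<in> carrier G" for u
    using that by (simp_all add: f_def g_def h_def F_central)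
  have conj: "inv (u \<otimes> h) \<otimes> v \<otimes> (u \<otimes> h) = inv u \<otimes> v \<otimes> u" if "u \<in> carrier G" "v \<in> carrier G" for u v
  proof -
    have "(inv u \<otimes> v \<otimes> u) \<otimes> h = h \<otimes> (inv u \<otimes> v \<otimes> u)" using that cen by simp
    then show ?thesis using that car by (simp add: m_assoc inv_mult_group mult_inv_cancel)
  qed
  have "(x \<rhd> y) \<rhd> z = inv z \<otimes> (inv y \<otimes> x \<otimes> y \<otimes> f) \<otimes> z \<otimes> g"
    using x y z by (simp add: op_eq[of _ z] f_def g_def) (simp add: op_eq)
  also have "\<dots> = inv z \<otimes> (inv y \<otimes> (x \<otimes> (y \<otimes> (z \<otimes> (g \<otimes> f)))))"
    using x y z car cen(1)[of "z \<otimes> g"] by (simp add: m_assoc)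
  also have "\<dots> = inv (inv z \<otimes> y \<otimes> z) \<otimes> (inv z \<otimes> x \<otimes> z \<otimes> g) \<otimes> (inv z \<otimes> y \<otimes> z) \<otimes> f"
  proof -
    have "g \<otimes> (inv z \<otimes> y \<otimes> z) \<otimes> f = (inv z \<otimes> y \<otimes> z) \<otimes> g \<otimes> f"
      using cen(2)[of "inv z \<otimes> y \<otimes> z"] y z by simp
    then have "g \<otimes> (inv z \<otimes> (y \<otimes> (z \<otimes> f))) = inv z \<otimes> (y \<otimes> (z \<otimes> (g \<otimes> f)))"
      using y z car by (simp add: m_assoc)
    then show ?thesis using x y z car
      by (simp add: m_assoc inv_mult_group mult_inv_cancel)
  qed
  also have "\<dots> = inv (y \<rhd> z) \<otimes> (x \<rhd> z) \<otimes> (y \<rhd> z) \<otimes> f"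
    using x y z car conj[of "inv z \<otimes> y \<otimes> z" "inv z \<otimes> x \<otimes> z \<otimes> g"]
    by (simp add: op_eq[of _ z] f_def g_def h_def)
  also have "\<dots> = (x \<rhd> z) \<rhd> (y \<rhd> z)"
    using x y z by (simp add: op_eq[of _ "y \<rhd> z"] f_def)
  finally show ?thesis .
qed

lemma quandle_Q: "quandle Q (\<rhd>)"
proof -
  have "\<one> \<in> Q" by (simp add: Q_iff)
  then show ?thesis
    unfolding quandle_def rack_def
    using op_bij op_self_distrib op_idem Q_carrier by blast
qed

lemma R_Bij: "k \<in> Q \<Longrightarrow> (\<lambda>y\<in>Q. y \<rhd> k) \<in> Bij Q"
  using op_bij[of k] by (simp add: Bij_def)

section \<open>Inner automorphisms and quasi-triviality\<close>

definition center_elts where "center_elts = {c \<in> carrier G. \<forall>y\<in>carrier G. c \<otimes> y = y \<otimes> c}"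

lemma center_eltsD: "c \<in> center_elts \<Longrightarrow> c \<in> carrier G"
  "\<lbrakk>c \<in> center_elts; y \<in> carrier G\<rbrakk> \<Longrightarrow> c \<otimes> y = y \<otimes> c"
  by (auto simp: center_elts_def)

lemma F_center: "F s t \<in> center_elts" "inv (F s t) \<in> center_elts"
proof -
  have "inv (F s t) \<otimes> y = y \<otimes> inv (F s t)" if "y \<in> carrier G" for y
    using commute_inv[OF F_central[OF that, symmetric] that F_closed] by (rule sym)
  then show "F s t \<in> center_elts" "inv (F s t) \<in> center_elts"
    unfolding center_elts_def using F_central by auto
qed

lemma center_elts_mult:
  assumes "c \<in> center_elts" "d \<in> center_elts"
  shows "c \<otimes> d \<in> center_elts"
proof -
  have "y \<otimes> (c \<otimes> d) = c \<otimes> d \<otimes> y" if "y \<in> carrier G" for y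
    using assms that center_eltsD(2)[OF assms(1) that, symmetric] center_eltsD(2)[OF assms(2) that, symmetric]
    by (intro commute_mult) (auto dest: center_eltsD(1))
  then have "\<forall>y\<in>carrier G. c \<otimes> d \<otimes> y = y \<otimes> (c \<otimes> d)" by metis
  moreover have "c \<otimes> d \<in> carrier G" using assms by (auto dest: center_eltsD(1))
  ultimately show ?thesis unfolding center_elts_def by blast
qed

lemma generate_Q_carrier: "a \<in> generate G Q \<Longrightarrow> a \<in> carrier G"
  using generate_in_carrier[of Q a] Q_carrier by blast

text \<open>Twists are central, so they collect in a single factor \<open>c\<close>; it may depend
  on \<open>x\<close>, whereas \<open>a\<close> may not. Membership in \<open>Bij Q\<close> is
  carried along because the product of \<open>BijGroup Q\<close> is composition only on
  \<open>Bij Q\<close>.\<close>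

lemma Inn_conj:
  assumes "\<phi> \<in> Inn Q (\<rhd>)"
  shows "\<phi> \<in> Bij Q \<and> (\<exists>a\<in>generate G Q. \<forall>x\<in>Q. \<kappa> (\<phi> x) = \<kappa> x \<and> (\<exists>c\<in>center_elts. \<phi> x = inv a \<otimes> x \<otimes> a \<otimes> c))"
  using assms unfolding Inn_def
proof (induction rule: generate.induct)
  case one
  have one_center: "\<one> \<in> center_elts" by (simp add: center_elts_def)
  have "\<one>\<^bsub>BijGroup Q\<^esub> \<in> Bij Q"
    using group.is_monoid[OF group_BijGroup, THEN monoid.one_closed, of Q] by (simp add: BijGroup_def)
  moreover have "\<one>\<^bsub>BijGroup Q\<^esub> x = x" if "x \<in> Q" for x using that by (simp add: BijGroup_def)
  ultimately show ?case
    by (auto intro!: bexI[of _ \<one>] generate.one one_center)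
next
  case (incl h)
  then obtain k where k: "k \<in> Q" and h: "h = (\<lambda>y\<in>Q. y \<rhd> k)" by auto
  show ?case
  proof (intro conjI bexI ballI)
    show "h \<in> Bij Q" using R_Bij[OF k] h by simp
    show "k \<in> generate G Q" using k by (rule generate.incl)
    fix x assume x: "x \<in> Q"
    show "\<kappa> (h x) = \<kappa> x" using x k by (simp add: h)
    show "h x = inv k \<otimes> x \<otimes> k \<otimes> F (\<kappa> x) (\<kappa> k)" using x k by (simp add: h op_eq)
    show "F (\<kappa> x) (\<kappa> k) \<in> center_elts" by (rule F_center)
  qed
next
  case (inv h)
  then obtain k where k: "k \<in> Q" and h: "h = (\<lambda>y\<in>Q. y \<rhd> k)" by auto
  have hB: "h \<in> Bij Q" using k h R_Bij by simp
  have inv_h: "inv\<^bsub>BijGroup Q\<^esub> h = (\<lambda>x\<in>Q. inv_into Q h x)" by (rule inv_BijGroup[OF hB])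
  have "inv\<^bsub>BijGroup Q\<^esub> h \<in> Bij Q"
  proof -
    have "carrier (BijGroup Q) = Bij Q" by (simp add: BijGroup_def)
    then show ?thesis using group.inv_closed[OF group_BijGroup, of h Q] hB by simp
  qed
  moreover have "\<kappa> ((inv\<^bsub>BijGroup Q\<^esub> h) x) = \<kappa> x \<and>
      (\<exists>c\<in>center_elts. (inv\<^bsub>BijGroup Q\<^esub> h) x = inv (inv k) \<otimes> x \<otimes> inv k \<otimes> c)" if x: "x \<in> Q" for x
  proof -
    define y where "y = inv_into Q h x"
    have "x \<in> h ` Q" using x hB by (auto simp: Bij_def bij_betw_def)
    then have y: "y \<in> Q" "h y = x" unfolding y_def by (auto intro: inv_into_into f_inv_into_f)
    then have yx: "y \<rhd> k = x" by (simp add: h)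
    have kap: "\<kappa> y = \<kappa> x" using yx y k kappa_op[of y k] by simp
    define f where "f = F (\<kappa> y) (\<kappa> k)"
    have f: "f \<in> carrier G" "\<And>u. u \<in> carrier G \<Longrightarrow> f \<otimes> u = u \<otimes> f" by (simp_all add: f_def F_central)
    have xeq: "x = inv k \<otimes> y \<otimes> k \<otimes> f" using yx by (simp add: op_eq f_def)
    have "k \<otimes> x \<otimes> inv k \<otimes> inv f = y \<otimes> (k \<otimes> (f \<otimes> inv k)) \<otimes> inv f"
      unfolding xeq using y k f(1) by (simp add: m_assoc mult_inv_cancel)
    also have "\<dots> = y" using y k f(1) f(2)[of "inv k"] by (simp add: m_assoc mult_inv_cancel)
    finally have "y = inv (inv k) \<otimes> x \<otimes> inv k \<otimes> inv f" using k by simp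
    then show ?thesis using x kap F_center(2) by (auto simp: inv_h y_def[symmetric] f_def)
  qed
  ultimately show ?case using generate.inv[OF k, of G] by blast
next
  case (eng h1 h2)
  then have B: "h1 \<in> Bij Q" "h2 \<in> Bij Q" by auto
  obtain a1 where a1: "a1 \<in> generate G Q" and
    h1: "\<And>x. x \<in> Q \<Longrightarrow> \<kappa> (h1 x) = \<kappa> x \<and> (\<exists>c\<in>center_elts. h1 x = inv a1 \<otimes> x \<otimes> a1 \<otimes> c)"
    using eng.IH(1) by auto
  obtain a2 where a2: "a2 \<in> generate G Q" and
    h2: "\<And>x. x \<in> Q \<Longrightarrow> \<kappa> (h2 x) = \<kappa> x \<and> (\<exists>c\<in>center_elts. h2 x = inv a2 \<otimes> x \<otimes> a2 \<otimes> c)"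
    using eng.IH(2) by auto
  \<comment> \<open>\<open>h2\<close> acts first, so the conjugating elements multiply in the
    opposite order, to \<open>a2 \<otimes> a1\<close>.\<close>
  have prod: "h1 \<otimes>\<^bsub>BijGroup Q\<^esub> h2 = compose Q h1 h2" using B by (simp add: BijGroup_def)
  have "\<kappa> (compose Q h1 h2 x) = \<kappa> x \<and>
      (\<exists>c\<in>center_elts. compose Q h1 h2 x = inv (a2 \<otimes> a1) \<otimes> x \<otimes> (a2 \<otimes> a1) \<otimes> c)" if x: "x \<in> Q" for x
  proof -
    have x2: "h2 x \<in> Q" using B(2) x by (auto simp: Bij_def bij_betw_def)
    obtain c2 where c2: "c2 \<in> center_elts" "h2 x = inv a2 \<otimes> x \<otimes> a2 \<otimes> c2" using h2[OF x] by auto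
    obtain c1 where c1: "c1 \<in> center_elts" "h1 (h2 x) = inv a1 \<otimes> h2 x \<otimes> a1 \<otimes> c1" using h1[OF x2] by auto
    note car = generate_Q_carrier[OF a1] generate_Q_carrier[OF a2] Q_carrier[OF x] center_eltsD(1)[OF c1(1)] center_eltsD(1)[OF c2(1)]
    have "h1 (h2 x) = inv a1 \<otimes> (inv a2 \<otimes> x \<otimes> a2) \<otimes> (c2 \<otimes> a1) \<otimes> c1"
      unfolding c1(2) unfolding c2(2) using car by (simp add: m_assoc)
    also have "\<dots> = inv (a2 \<otimes> a1) \<otimes> x \<otimes> (a2 \<otimes> a1) \<otimes> (c2 \<otimes> c1)"
      using car center_eltsD(2)[OF c2(1), of a1] by (simp add: m_assoc inv_mult_group)
    finally show ?thesis using x center_elts_mult[OF c2(1) c1(1)] h1[OF x2] h2[OF x]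
      by (auto simp: compose_eq)
  qed
  moreover have "a2 \<otimes> a1 \<in> generate G Q" using a1 a2 by (rule generate.eng[rotated])
  ultimately show ?case using B by (auto simp: prod intro!: compose_Bij)
qed

text \<open>From \<open>\<kappa> h = \<kappa> g\<close> and \<open>g \<in> Q\<close> the twist in
  \<open>g \<rhd> h\<close> is \<open>F (\<kappa> g) (\<kappa> g) = \<one>\<close>, and the central
  factor of \<open>h\<close> drops out of the conjugation.\<close>

lemma op_conj_fixes_iff:
  assumes g: "g \<in> Q" and x: "x \<in> carrier G" and c: "c \<in> center_elts"
    and h: "h = x \<otimes> c" "\<kappa> h = \<kappa> g"
  shows "g \<rhd> h = g \<longleftrightarrow> g \<otimes> x = x \<otimes> g"
proof -
  note car = Q_carrier[OF g] x center_eltsD(1)[OF c]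
  have "h \<in> carrier G" using car h by simp
  then have "g \<rhd> h = inv h \<otimes> g \<otimes> h" using g h(2) by (simp add: op_eq Q_iff)
  also have "\<dots> = inv c \<otimes> (inv x \<otimes> g \<otimes> x \<otimes> c)" unfolding h(1) using car by (simp add: m_assoc inv_mult_group)
  also have "inv x \<otimes> g \<otimes> x \<otimes> c = c \<otimes> (inv x \<otimes> g \<otimes> x)" using car center_eltsD(2)[OF c] by simp
  finally have *: "g \<rhd> h = inv x \<otimes> (g \<otimes> x)" using car by (simp add: mult_inv_cancel m_assoc)
  have "inv x \<otimes> (g \<otimes> x) = g" if "g \<otimes> x = x \<otimes> g"
    unfolding that using car by (simp add: mult_inv_cancel)
  moreover have "g \<otimes> x = x \<otimes> g" if "inv x \<otimes> (g \<otimes> x) = g"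
  proof -
    have "x \<otimes> g = x \<otimes> (inv x \<otimes> (g \<otimes> x))" by (simp only: that)
    also have "\<dots> = g \<otimes> x" using car by (simp add: mult_inv_cancel)
    finally show ?thesis by (rule sym)
  qed
  ultimately have "inv x \<otimes> (g \<otimes> x) = g \<longleftrightarrow> g \<otimes> x = x \<otimes> g" by (rule iffI[rotated])
  then show ?thesis by (simp only: *)
qed

lemma group_commutator_eq_one_iff:
  assumes x: "x \<in> carrier G" and y: "y \<in> carrier G"
  shows "group_commutator G x y = \<one> \<longleftrightarrow> x \<otimes> y = y \<otimes> x"
proof
  assume "group_commutator G x y = \<one>"
  then have "x \<otimes> y \<otimes> inv x \<otimes> inv y \<otimes> (y \<otimes> x) = \<one> \<otimes> (y \<otimes> x)"
    unfolding group_commutator_def by (rule arg_cong)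
  then show "x \<otimes> y = y \<otimes> x" using x y by (simp add: m_assoc mult_inv_cancel)
next
  assume "x \<otimes> y = y \<otimes> x"
  then show "group_commutator G x y = \<one>"
    unfolding group_commutator_def using x y by (simp add: m_assoc mult_inv_cancel)
qed

text \<open>The arbitrary start \<open>d\<close> carries the induction: generators and their
  inverses are appended on the right, one at a time, and for a product
  \<open>a1 \<otimes> a2\<close> the second induction hypothesis is applied at
  \<open>d \<otimes> a1\<close>.\<close>

lemma generate_Q_conj_commute:
  assumes eng: "\<And>g k. \<lbrakk>g \<in> Q; k \<in> Q\<rbrakk> \<Longrightarrow> g \<otimes> (inv k \<otimes> g \<otimes> k) = (inv k \<otimes> g \<otimes> k) \<otimes> g"
    and a: "a \<in> generate G Q" and g: "g \<in> Q" and d: "d \<in> carrier G"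
    and gd: "g \<otimes> (inv d \<otimes> g \<otimes> d) = (inv d \<otimes> g \<otimes> d) \<otimes> g"
  shows "g \<otimes> (inv (d \<otimes> a) \<otimes> g \<otimes> (d \<otimes> a)) = (inv (d \<otimes> a) \<otimes> g \<otimes> (d \<otimes> a)) \<otimes> g"
  using a d gd
proof (induction arbitrary: d rule: generate.induct)
  case one
  then show ?case by simp
next
  case (incl b)
  define c where "c = inv g \<otimes> (inv d \<otimes> g \<otimes> d)"
  have c: "c \<in> carrier G" "\<kappa> c = 0" using g incl(1,2) by (simp_all add: c_def kappa_mult kappa_inv)
  have bc: "b \<otimes> c \<in> Q" using c incl(1) by (auto simp: kappa_mult intro: Q_if_kappa_eq[OF incl(1)])
  show ?case
    by (rule conjugates_commute_step(1)[OF Q_carrier[OF g] incl(2) Q_carrier[OF incl(1)] c_def incl(3)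
          eng[OF g incl(1)] eng[OF incl(1) g] eng[OF bc g]])
next
  case (inv b)
  define c where "c = inv g \<otimes> (inv d \<otimes> g \<otimes> d)"
  have c: "c \<in> carrier G" "\<kappa> c = 0" using g inv(1,2) by (simp_all add: c_def kappa_mult kappa_inv)
  have bc: "b \<otimes> c \<in> Q" using c inv(1) by (auto simp: kappa_mult intro: Q_if_kappa_eq[OF inv(1)])
  show ?case
    by (rule conjugates_commute_step(2)[OF Q_carrier[OF g] inv(2) Q_carrier[OF inv(1)] c_def inv(3)
          eng[OF g inv(1)] eng[OF inv(1) g] eng[OF bc g]])
next
  case (eng a1 a2)
  have car: "a1 \<in> carrier G" "a2 \<in> carrier G" using eng generate_Q_carrier by auto
  from eng.IH(2)[OF m_closed[OF eng.prems(1) car(1)] eng.IH(1)[OF eng.prems]]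
  show ?case by (simp only: m_assoc[OF eng.prems(1) car])
qed

text \<open>The map \<open>y\<close> to \<open>y \<rhd> k\<close> is itself inner, which yields the
  commutator condition; the converse combines \<open>Inn_conj\<close> with
  \<open>generate_Q_conj_commute\<close> started at \<open>\<one>\<close>.\<close>

theorem quasi_trivial_iff:
  "quasi_trivial Q (\<rhd>) \<longleftrightarrow> (\<forall>g\<in>Q. \<forall>k\<in>Q. group_commutator G g (inv k \<otimes> g \<otimes> k) = \<one>)"
proof
  assume qt: "quasi_trivial Q (\<rhd>)"
  show "\<forall>g\<in>Q. \<forall>k\<in>Q. group_commutator G g (inv k \<otimes> g \<otimes> k) = \<one>"
  proof (intro ballI)
    fix g k assume gk: "g \<in> Q" "k \<in> Q"
    then have "(\<lambda>y\<in>Q. y \<rhd> k) \<in> Inn Q (\<rhd>)" unfolding Inn_def by (auto intro: generate.incl)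
    then have "g \<rhd> (g \<rhd> k) = g" using qt gk unfolding quasi_trivial_def by fastforce
    then have "g \<otimes> (inv k \<otimes> g \<otimes> k) = (inv k \<otimes> g \<otimes> k) \<otimes> g"
      using op_conj_fixes_iff[OF gk(1) _ F_center(1) op_eq[of g k]] gk by simp
    then show "group_commutator G g (inv k \<otimes> g \<otimes> k) = \<one>"
      using gk by (simp add: group_commutator_eq_one_iff)
  qed
next
  assume "\<forall>g\<in>Q. \<forall>k\<in>Q. group_commutator G g (inv k \<otimes> g \<otimes> k) = \<one>"
  then have eng: "g \<otimes> (inv k \<otimes> g \<otimes> k) = (inv k \<otimes> g \<otimes> k) \<otimes> g" if "g \<in> Q" "k \<in> Q" for g k
    using that by (simp add: group_commutator_eq_one_iff)
  show "quasi_trivial Q (\<rhd>)"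
    unfolding quasi_trivial_def
  proof (intro ballI)
    fix x \<phi> assume x: "x \<in> Q" and \<phi>: "\<phi> \<in> Inn Q (\<rhd>)"
    obtain a where a: "a \<in> generate G Q" and
      *: "\<kappa> (\<phi> x) = \<kappa> x \<and> (\<exists>c\<in>center_elts. \<phi> x = inv a \<otimes> x \<otimes> a \<otimes> c)"
      using Inn_conj[OF \<phi>] x by auto
    have "x \<otimes> (inv a \<otimes> x \<otimes> a) = (inv a \<otimes> x \<otimes> a) \<otimes> x"
      using generate_Q_conj_commute[OF eng a x one_closed] x generate_Q_carrier[OF a] by simp
    then show "x \<rhd> \<phi> x = x"
      using * op_conj_fixes_iff[OF x _ _ _ conjunct1[OF *], of "inv a \<otimes> x \<otimes> a"] x generate_Q_carrier[OF a]
      by fastforce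
  qed
qed

end

section \<open>Calculus of \<open>C\<^sup>k\<close> maps\<close>

lemma Ck_on_subset: "Ck_on k S f \<Longrightarrow> T \<subseteq> S \<Longrightarrow> Ck_on k T f"
  by (induction k arbitrary: f) (auto intro: continuous_on_subset)

lemma Ck_on_cong:
  assumes "open S" "\<And>x. x \<in> S \<Longrightarrow> f x = g x" "Ck_on k S f"
  shows "Ck_on k S g"
  using assms(2,3)
proof (induction k arbitrary: f g)
  case 0
  then show ?case by (simp cong: continuous_on_cong)
next
  case (Suc k)
  have der: "(g has_derivative frechet_derivative f (at x)) (at x)" if "x \<in> S" for x
    using has_derivative_transform_within_open[OF _ assms(1) that Suc.prems(1)] Suc.prems(2) that
    by (simp add: frechet_derivative_works)
  then have "frechet_derivative f (at x) = frechet_derivative g (at x)" if "x \<in> S" for x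
    using that frechet_derivative_at by blast
  moreover have "g differentiable at x" if "x \<in> S" for x
    using der[OF that] by (auto simp: differentiable_def)
  ultimately show ?case
    using Suc.prems(2) Suc.IH[of "\<lambda>x. frechet_derivative f (at x) v" "\<lambda>x. frechet_derivative g (at x) v" for v]
    by simp
qed

text \<open>Allows an explicit derivative in place of \<open>frechet_derivative\<close>; on an open
  set the two agree by uniqueness.\<close>

lemma Ck_on_SucI:
  assumes "open S" "\<And>x. x \<in> S \<Longrightarrow> (f has_derivative f' x) (at x)" "\<And>v. Ck_on k S (\<lambda>x. f' x v)"
  shows "Ck_on (Suc k) S f"
proof -
  have "f' x = frechet_derivative f (at x)" if "x \<in> S" for x
    using assms(2)[OF that] by (rule frechet_derivative_at)
  then have "Ck_on k S (\<lambda>x. frechet_derivative f (at x) v)" for v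
    using Ck_on_cong[OF assms(1) _ assms(3)[of v]] by simp
  then show ?thesis using assms(2) by (auto simp: differentiable_def)
qed

lemma Ck_on_Suc_has_derivative:
  "\<lbrakk>Ck_on (Suc k) S f; x \<in> S\<rbrakk> \<Longrightarrow> (f has_derivative frechet_derivative f (at x)) (at x)"
  by (simp add: frechet_derivative_works)

lemma Ck_on_SucD: "Ck_on (Suc k) S f \<Longrightarrow> Ck_on k S f"
proof (induction k arbitrary: f)
  case 0
  then show ?case
    by (simp add: continuous_at_imp_continuous_on differentiable_imp_continuous_within)
next
  case (Suc k)
  then show ?case by (metis Ck_on.simps(2))
qed

lemma Ck_on_const: "open S \<Longrightarrow> Ck_on k S (\<lambda>x. c)"
  by (induction k arbitrary: c) (auto intro!: Ck_on_SucI derivative_eq_intros simp del: Ck_on.simps(2))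

lemma Ck_on_linear:
  assumes "bounded_linear h" "open S"
  shows "Ck_on k S h"
proof (cases k)
  case 0
  then show ?thesis using assms by (simp add: linear_continuous_on)
next
  case (Suc n)
  have "Ck_on (Suc n) S h"
    by (rule Ck_on_SucI[OF assms(2) bounded_linear_imp_has_derivative[OF assms(1)] Ck_on_const[OF assms(2)]])
  then show ?thesis by (simp only: Suc)
qed

lemma Ck_on_add:
  "\<lbrakk>open S; Ck_on k S f; Ck_on k S g\<rbrakk> \<Longrightarrow> Ck_on k S (\<lambda>x. f x + g x)"
proof (induction k arbitrary: f g)
  case (Suc k)
  show ?case
  proof (rule Ck_on_SucI[OF Suc.prems(1)])
    show "((\<lambda>x. f x + g x) has_derivative (\<lambda>v. frechet_derivative f (at x) v + frechet_derivative g (at x) v)) (at x)"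
      if "x \<in> S" for x
      by (intro has_derivative_add Ck_on_Suc_has_derivative[OF Suc.prems(2) that] Ck_on_Suc_has_derivative[OF Suc.prems(3) that])
    show "Ck_on k S (\<lambda>x. frechet_derivative f (at x) v + frechet_derivative g (at x) v)" for v
      using Suc by auto
  qed
qed (auto intro: continuous_intros)

lemma Ck_on_sum:
  assumes "open S" "\<And>i. i \<in> I \<Longrightarrow> Ck_on k S (f i)"
  shows "Ck_on k S (\<lambda>x. \<Sum>i\<in>I. f i x)"
  using assms(2)
  by (induction I rule: infinite_finite_induct) (auto intro!: Ck_on_add Ck_on_const assms(1))

lemma Ck_on_bounded_linear:
  assumes "bounded_linear h"
  shows "\<lbrakk>open S; Ck_on k S f\<rbrakk> \<Longrightarrow> Ck_on k S (\<lambda>x. h (f x))"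
proof (induction k arbitrary: f)
  case 0
  then show ?case using assms by (auto intro: bounded_linear.continuous_on)
next
  case (Suc k)
  show ?case
  proof (rule Ck_on_SucI[OF Suc.prems(1)])
    show "((\<lambda>x. h (f x)) has_derivative (\<lambda>v. h (frechet_derivative f (at x) v))) (at x)" if "x \<in> S" for x
      by (intro bounded_linear.has_derivative[OF assms] Ck_on_Suc_has_derivative[OF Suc.prems(2) that])
    show "Ck_on k S (\<lambda>x. h (frechet_derivative f (at x) v))" for v
      using Suc by auto
  qed
qed

lemma Ck_on_bounded_bilinear:
  assumes "bounded_bilinear h"
  shows "\<lbrakk>open S; Ck_on k S f; Ck_on k S g\<rbrakk> \<Longrightarrow> Ck_on k S (\<lambda>x. h (f x) (g x))"
proof (induction k arbitrary: f g)
  case 0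
  then show ?case using assms by (auto intro: bounded_bilinear.continuous_on)
next
  case (Suc k)
  show ?case
  proof (rule Ck_on_SucI[OF Suc.prems(1)])
    show "((\<lambda>x. h (f x) (g x)) has_derivative
        (\<lambda>v. h (f x) (frechet_derivative g (at x) v) + h (frechet_derivative f (at x) v) (g x))) (at x)"
      if "x \<in> S" for x
      by (intro bounded_bilinear.FDERIV[OF assms] Ck_on_Suc_has_derivative[OF Suc.prems(2) that]
          Ck_on_Suc_has_derivative[OF Suc.prems(3) that])
    show "Ck_on k S (\<lambda>x. h (f x) (frechet_derivative g (at x) v) + h (frechet_derivative f (at x) v) (g x))" for v
      using Suc.prems Suc.IH[of f "\<lambda>x. frechet_derivative g (at x) v"]
        Suc.IH[of "\<lambda>x. frechet_derivative f (at x) v" g] Ck_on_SucD[OF Suc.prems(2)] Ck_on_SucD[OF Suc.prems(3)]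
      by (intro Ck_on_add) auto
  qed
qed

text \<open>The direction \<open>L v\<close> does not depend on \<open>x\<close>, so the induction
  stays within fixed directional derivatives. It serves the slices of a map on a product space along
  one factor.\<close>

lemma Ck_on_affine:
  assumes L: "bounded_linear L" and "open S" "open T" "\<And>x. x \<in> T \<Longrightarrow> L x + c \<in> S"
  shows "Ck_on k S f \<Longrightarrow> Ck_on k T (\<lambda>x. f (L x + c))"
proof (induction k arbitrary: f)
  case 0
  have "continuous_on T (\<lambda>x. L x + c)"
    by (intro continuous_intros bounded_linear.continuous_on[OF L])
  then show ?case using 0 assms(4) by (auto intro: continuous_on_compose2)
next
  case (Suc k)
  show ?case
  proof (rule Ck_on_SucI[OF assms(3)])
    have "((\<lambda>x. L x + c) has_derivative L) (at x)" for x
      using bounded_linear_imp_has_derivative[OF L] by (auto intro!: derivative_eq_intros)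
    then show "((\<lambda>x. f (L x + c)) has_derivative (\<lambda>v. frechet_derivative f (at (L x + c)) (L v))) (at x)" if "x \<in> T" for x
      using Ck_on_Suc_has_derivative[OF Suc.prems assms(4)[OF that]] by (rule has_derivative_compose)
    show "Ck_on k T (\<lambda>x. frechet_derivative f (at (L x + c)) (L v))" for v
      using Suc.IH[of "\<lambda>x. frechet_derivative f (at x) (L v)"] Suc.prems by auto
  qed
qed

section \<open>Coordinates and the chain rule\<close>

text \<open>The remainder after subtracting all projections is orthogonal to \<open>B\<close>, hence
  to its span, hence to itself. A zero vector in \<open>B\<close> is harmless, its coefficient being
  \<open>0\<close> by the convention for division.\<close>

lemma finite_dimensional_coordinates:
  assumes "finite_dimensional_UNIV TYPE('l::real_inner)"
  obtains B :: "'l::real_inner set" where "finite B" "\<And>x. x = (\<Sum>b\<in>B. (x \<bullet> b / (b \<bullet> b)) *\<^sub>R b)"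
proof -
  obtain B0 :: "'l set" where "finite B0" "span B0 = UNIV"
    using assms by (auto simp: finite_dimensional_UNIV_def)
  then obtain B :: "'l set" where B: "finite B" "span B = UNIV" "pairwise orthogonal B"
    using basis_orthogonal[of B0] by auto
  have "x = (\<Sum>b\<in>B. (x \<bullet> b / (b \<bullet> b)) *\<^sub>R b)" for x
  proof -
    define y where "y = x - (\<Sum>b\<in>B. (x \<bullet> b / (b \<bullet> b)) *\<^sub>R b)"
    have "y \<bullet> c = 0" if c: "c \<in> B" for c
    proof -
      have "(\<Sum>b\<in>B. (x \<bullet> b / (b \<bullet> b)) *\<^sub>R b) \<bullet> c = (\<Sum>b\<in>B. if b = c then x \<bullet> c else 0)"
        unfolding inner_sum_left using B(3) c
        by (intro sum.cong) (auto simp: pairwise_def orthogonal_def)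
      then show ?thesis using c B(1) by (simp add: y_def inner_diff_left)
    qed
    moreover have "y \<in> span B" using B by simp
    ultimately have "orthogonal y y"
      by (intro orthogonal_to_span[of y B]) (auto simp: orthogonal_def inner_commute)
    then show ?thesis by (simp add: orthogonal_def y_def)
  qed
  with B(1) show ?thesis by (rule that)
qed

text \<open>The derivative of \<open>h\<close> is taken at \<open>f x\<close> in a direction that
  varies with \<open>x\<close>, while \<open>Ck_on\<close> controls fixed directions only. Expanding
  the direction in \<open>B\<close> leaves scalar coefficients times derivatives of \<open>h\<close>
  in the fixed directions \<open>b\<close>.\<close>

lemma Ck_on_compose:
  fixes f :: "'e::real_normed_vector \<Rightarrow> 'f::real_inner" and h :: "'f \<Rightarrow> 'g::real_normed_vector"
  assumes fd: "finite_dimensional_UNIV TYPE('f)" and S: "open S" and T: "open T" and sub: "f ` S \<subseteq> T"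
  shows "\<lbrakk>Ck_on k S f; Ck_on k T h\<rbrakk> \<Longrightarrow> Ck_on k S (\<lambda>x. h (f x))"
proof (induction k arbitrary: h)
  case 0
  then show ?case using sub by (auto intro: continuous_on_compose2)
next
  case (Suc k)
  obtain B :: "'f set" where B: "finite B" "\<And>x. x = (\<Sum>b\<in>B. (x \<bullet> b / (b \<bullet> b)) *\<^sub>R b)"
    using finite_dimensional_coordinates[OF fd] by blast
  let ?Df = "\<lambda>x. frechet_derivative f (at x)" and ?Dh = "\<lambda>y. frechet_derivative h (at y)"
  show ?case
  proof (rule Ck_on_SucI[OF S])
    fix x assume x: "x \<in> S"
    then have Dh: "(h has_derivative ?Dh (f x)) (at (f x))"
      using Ck_on_Suc_has_derivative[OF Suc.prems(2)] sub by auto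
    have eq: "?Dh (f x) w = (\<Sum>b\<in>B. (w \<bullet> b / (b \<bullet> b)) *\<^sub>R ?Dh (f x) b)" for w
      by (subst B(2)[of w]) (simp add: linear_sum[OF has_derivative_linear[OF Dh]] linear_cmul[OF has_derivative_linear[OF Dh]])
    show "((\<lambda>x. h (f x)) has_derivative
        (\<lambda>v. \<Sum>b\<in>B. (?Df x v \<bullet> b / (b \<bullet> b)) *\<^sub>R ?Dh (f x) b)) (at x)"
      by (rule has_derivative_eq_rhs[OF has_derivative_compose[OF Ck_on_Suc_has_derivative[OF Suc.prems(1) x] Dh]])
        (rule ext, rule eq)
  next
    fix v
    have "bounded_linear (\<lambda>w. w \<bullet> b / (b \<bullet> b))" for b :: 'f
      by (intro bounded_linear_compose[OF bounded_linear_divide bounded_linear_inner_left])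
    then have "Ck_on k S (\<lambda>x. ?Df x v \<bullet> b / (b \<bullet> b))" for b
      using Suc.prems(1) S by (intro Ck_on_bounded_linear[of "\<lambda>w. w \<bullet> b / (b \<bullet> b)"]) auto
    moreover have "Ck_on k S (\<lambda>x. ?Dh (f x) b)" for b
      using Suc.IH[OF Ck_on_SucD[OF Suc.prems(1)], of "\<lambda>y. ?Dh y b"] Suc.prems(2) by auto
    ultimately show "Ck_on k S (\<lambda>x. \<Sum>b\<in>B. (?Df x v \<bullet> b / (b \<bullet> b)) *\<^sub>R ?Dh (f x) b)"
      by (intro Ck_on_sum S Ck_on_bounded_bilinear[OF bounded_bilinear_scaleR])
  qed
qed

section \<open>Symmetry of second derivatives\<close>

text \<open>Two applications of the mean value theorem: along \<open>u\<close> to the increment in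
  direction \<open>h v\<close>, then along \<open>v\<close> to the derivative obtained. The left
  side is symmetric in \<open>u\<close> and \<open>v\<close>.\<close>

lemma second_difference_mean_value:
  fixes f :: "'e::real_normed_vector \<Rightarrow> real"
  assumes f: "Ck_on 2 S f" and h: "h > 0"
    and in_S: "\<And>s t. \<lbrakk>0 \<le> s; s \<le> h; 0 \<le> t; t \<le> h\<rbrakk> \<Longrightarrow> p + s *\<^sub>R u + t *\<^sub>R v \<in> S"
  shows "\<exists>s t. 0 < s \<and> s < h \<and> 0 < t \<and> t < h \<and>
    f (p + h *\<^sub>R u + h *\<^sub>R v) - f (p + h *\<^sub>R u) - f (p + h *\<^sub>R v) + f p
      = h * h * frechet_derivative (\<lambda>x. frechet_derivative f (at x) u) (at (p + s *\<^sub>R u + t *\<^sub>R v)) v"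
proof -
  let ?D = "\<lambda>x. frechet_derivative f (at x)"
  have f1: "Ck_on (Suc 1) S f" using f by (simp add: numeral_2_eq_2)
  then have Df: "Ck_on (Suc 0) S (\<lambda>x. ?D x u)" by simp
  have der1: "((\<lambda>s. f (p + s *\<^sub>R u + t *\<^sub>R v)) has_real_derivative ?D (p + s *\<^sub>R u + t *\<^sub>R v) u) (at s)"
    if "0 \<le> s" "s \<le> h" "0 \<le> t" "t \<le> h" for s t
  proof -
    have d: "(f has_derivative ?D (p + s *\<^sub>R u + t *\<^sub>R v)) (at (p + s *\<^sub>R u + t *\<^sub>R v))"
      using f1 in_S[OF that] by (rule Ck_on_Suc_has_derivative)
    have "((\<lambda>s. p + s *\<^sub>R u + t *\<^sub>R v) has_derivative (\<lambda>r. r *\<^sub>R u)) (at s)"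
      by (auto intro!: derivative_eq_intros)
    from has_derivative_compose[OF this d]
    have "((\<lambda>s. f (p + s *\<^sub>R u + t *\<^sub>R v)) has_derivative (\<lambda>r. ?D (p + s *\<^sub>R u + t *\<^sub>R v) (r *\<^sub>R u))) (at s)" .
    moreover have "?D (p + s *\<^sub>R u + t *\<^sub>R v) (r *\<^sub>R u) = ?D (p + s *\<^sub>R u + t *\<^sub>R v) u * r" for r
      using linear_cmul[OF has_derivative_linear[OF Ck_on_Suc_has_derivative[OF f1 in_S[OF that]]]] by simp
    ultimately show ?thesis by (simp add: has_field_derivative_def)
  qed
  have der2: "((\<lambda>t. ?D (p + s *\<^sub>R u + t *\<^sub>R v) u) has_real_derivative
      frechet_derivative (\<lambda>x. ?D x u) (at (p + s *\<^sub>R u + t *\<^sub>R v)) v) (at t)"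
    if "0 \<le> s" "s \<le> h" "0 \<le> t" "t \<le> h" for s t
  proof -
    let ?q = "p + s *\<^sub>R u + t *\<^sub>R v"
    have d: "((\<lambda>x. ?D x u) has_derivative frechet_derivative (\<lambda>x. ?D x u) (at ?q)) (at ?q)"
      using Df in_S[OF that] by (rule Ck_on_Suc_has_derivative)
    have "((\<lambda>t. p + s *\<^sub>R u + t *\<^sub>R v) has_derivative (\<lambda>r. r *\<^sub>R v)) (at t)"
      by (auto intro!: derivative_eq_intros)
    from has_derivative_compose[OF this d]
    have "((\<lambda>t. ?D (p + s *\<^sub>R u + t *\<^sub>R v) u) has_derivative (\<lambda>r. frechet_derivative (\<lambda>x. ?D x u) (at ?q) (r *\<^sub>R v))) (at t)" .
    moreover have "frechet_derivative (\<lambda>x. ?D x u) (at ?q) (r *\<^sub>R v) = frechet_derivative (\<lambda>x. ?D x u) (at ?q) v * r" for r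
      using linear_cmul[OF has_derivative_linear[OF d]] by simp
    ultimately show ?thesis by (simp add: has_field_derivative_def)
  qed
  define g where "g s = f (p + s *\<^sub>R u + h *\<^sub>R v) - f (p + s *\<^sub>R u + 0 *\<^sub>R v)" for s
  have "\<exists>s. 0 < s \<and> s < h \<and> g h - g 0 = (h - 0) * (?D (p + s *\<^sub>R u + h *\<^sub>R v) u - ?D (p + s *\<^sub>R u + 0 *\<^sub>R v) u)"
    unfolding g_def by (rule MVT2[OF h]) (intro DERIV_diff der1; use h in simp)
  then obtain s where s: "0 < s" "s < h"
    "g h - g 0 = h * (?D (p + s *\<^sub>R u + h *\<^sub>R v) u - ?D (p + s *\<^sub>R u + 0 *\<^sub>R v) u)" by auto
  have "\<exists>t. 0 < t \<and> t < h \<and> ?D (p + s *\<^sub>R u + h *\<^sub>R v) u - ?D (p + s *\<^sub>R u + 0 *\<^sub>R v) u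
      = (h - 0) * frechet_derivative (\<lambda>x. ?D x u) (at (p + s *\<^sub>R u + t *\<^sub>R v)) v"
    by (rule MVT2[OF h]) (intro der2; use s in simp)
  then obtain t where t: "0 < t" "t < h" "?D (p + s *\<^sub>R u + h *\<^sub>R v) u - ?D (p + s *\<^sub>R u + 0 *\<^sub>R v) u
      = h * frechet_derivative (\<lambda>x. ?D x u) (at (p + s *\<^sub>R u + t *\<^sub>R v)) v" by auto
  show ?thesis
    using s t by (intro exI[of _ s] exI[of _ t]) (simp add: g_def algebra_simps)
qed

text \<open>The same second difference equals \<open>h * h\<close> times either mixed derivative at
  some point near \<open>p\<close>; continuity at \<open>p\<close> makes the two values agree up to
  any \<open>e\<close>.\<close>

lemma frechet_derivative_commute_real:
  fixes f :: "'e::real_normed_vector \<Rightarrow> real"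
  assumes S: "open S" and f: "Ck_on 2 S f" and p: "p \<in> S"
  shows "frechet_derivative (\<lambda>x. frechet_derivative f (at x) u) (at p) v
    = frechet_derivative (\<lambda>x. frechet_derivative f (at x) v) (at p) u"
proof -
  define D where "D u v x = frechet_derivative (\<lambda>x. frechet_derivative f (at x) u) (at x) v" for u v x
  have cont: "continuous_on S (D u v)" for u v
    using f unfolding D_def by (simp add: numeral_2_eq_2)
  have "\<bar>D u v p - D v u p\<bar> \<le> e" if e: "e > 0" for e
  proof -
    have "\<forall>\<^sub>F x in nhds p. \<bar>D a b x - D a b p\<bar> < e / 2" for a b
    proof -
      have "isCont (D a b) p" using cont S p by (simp add: continuous_on_eq_continuous_at)
      then have "(D a b \<longlongrightarrow> D a b p) (nhds p)" by (simp add: isCont_def tendsto_at_iff_tendsto_nhds)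
      from tendstoD[OF this, of "e / 2"] e show ?thesis by (simp add: dist_real_def)
    qed
    then have "\<forall>\<^sub>F x in nhds p. x \<in> S \<and> \<bar>D u v x - D u v p\<bar> < e / 2 \<and> \<bar>D v u x - D v u p\<bar> < e / 2"
      using S p by (intro eventually_conj eventually_nhds_in_open)
    then obtain d where d: "d > 0" and near: "\<And>x. dist x p < d \<Longrightarrow>
        x \<in> S \<and> \<bar>D u v x - D u v p\<bar> < e / 2 \<and> \<bar>D v u x - D v u p\<bar> < e / 2"
      unfolding eventually_nhds_metric by auto
    \<comment> \<open>With \<open>h = d / (2 * N)\<close> the parallelogram at \<open>p\<close>
      spanned by \<open>h u\<close> and \<open>h v\<close> stays within distance
      \<open>d / 2\<close>; the summand \<open>1\<close> keeps \<open>N\<close> positive when both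
      vectors vanish.\<close>
    define N where "N = norm u + norm v + 1"
    define h where "h = d / (2 * N)"
    have pos: "N > 0" by (simp add: N_def add_nonneg_pos)
    then have h: "h > 0" using d by (simp add: h_def)
    have close: "dist (p + s *\<^sub>R u + t *\<^sub>R v) p < d" if "0 \<le> s" "s \<le> h" "0 \<le> t" "t \<le> h" for s t
    proof -
      have "dist (p + s *\<^sub>R u + t *\<^sub>R v) p \<le> s * norm u + t * norm v"
        using norm_triangle_ineq[of "s *\<^sub>R u" "t *\<^sub>R v"] that by (simp add: dist_norm)
      also have "\<dots> \<le> h * norm u + h * norm v"
        using that by (intro add_mono mult_right_mono) auto
      also have "\<dots> < h * N" using h by (simp add: N_def algebra_simps)
      also have "\<dots> = d / 2" using pos by (simp add: h_def)
      finally show ?thesis using d by simp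
    qed
    have in_S: "p + s *\<^sub>R u + t *\<^sub>R v \<in> S" if "0 \<le> s" "s \<le> h" "0 \<le> t" "t \<le> h" for s t
      using near[OF close[OF that]] by blast
    obtain s t where st: "0 < s" "s < h" "0 < t" "t < h" "f (p + h *\<^sub>R u + h *\<^sub>R v) - f (p + h *\<^sub>R u) - f (p + h *\<^sub>R v) + f p
      = h * h * D u v (p + s *\<^sub>R u + t *\<^sub>R v)"
      using second_difference_mean_value[OF f h in_S] unfolding D_def by blast
    have close': "dist (p + s *\<^sub>R v + t *\<^sub>R u) p < d" if "0 \<le> s" "s \<le> h" "0 \<le> t" "t \<le> h" for s t
      using close[of t s] that by (simp add: algebra_simps)
    have in_S': "p + s *\<^sub>R v + t *\<^sub>R u \<in> S" if "0 \<le> s" "s \<le> h" "0 \<le> t" "t \<le> h" for s t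
      using near[OF close'[OF that]] by blast
    obtain s' t' where st': "0 < s'" "s' < h" "0 < t'" "t' < h" "f (p + h *\<^sub>R v + h *\<^sub>R u) - f (p + h *\<^sub>R v) - f (p + h *\<^sub>R u) + f p
      = h * h * D v u (p + s' *\<^sub>R v + t' *\<^sub>R u)"
      using second_difference_mean_value[OF f h in_S'] unfolding D_def by blast
    have "h * h * D u v (p + s *\<^sub>R u + t *\<^sub>R v) = h * h * D v u (p + s' *\<^sub>R v + t' *\<^sub>R u)"
      using st(5) st'(5) by (simp add: algebra_simps)
    then have "D u v (p + s *\<^sub>R u + t *\<^sub>R v) = D v u (p + s' *\<^sub>R v + t' *\<^sub>R u)" using h by simp
    moreover have "\<bar>D u v (p + s *\<^sub>R u + t *\<^sub>R v) - D u v p\<bar> < e / 2" using near close st by auto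
    moreover have "\<bar>D v u (p + s' *\<^sub>R v + t' *\<^sub>R u) - D v u p\<bar> < e / 2" using near close' st' by auto
    ultimately show ?thesis by linarith
  qed
  then have "\<bar>D u v p - D v u p\<bar> \<le> 0" by (rule field_le_epsilon) auto
  then show ?thesis by (simp add: D_def)
qed

lemma frechet_derivative_commute:
  fixes f :: "'e::real_normed_vector \<Rightarrow> 'f::real_inner"
  assumes S: "open S" and f: "Ck_on 2 S f" and p: "p \<in> S"
  shows "frechet_derivative (\<lambda>x. frechet_derivative f (at x) u) (at p) v
    = frechet_derivative (\<lambda>x. frechet_derivative f (at x) v) (at p) u"
proof -
  have f1: "Ck_on (Suc (Suc 0)) S f" using f by (simp add: numeral_2_eq_2)
  have *: "frechet_derivative (\<lambda>x. frechet_derivative (\<lambda>x. f x \<bullet> e) (at x) u) (at p) v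
      = frechet_derivative (\<lambda>x. frechet_derivative f (at x) u) (at p) v \<bullet> e" for e u v
  proof -
    have "((\<lambda>x. f x \<bullet> e) has_derivative (\<lambda>w. frechet_derivative f (at x) w \<bullet> e)) (at x)" if "x \<in> S" for x
      by (rule bounded_linear.has_derivative[OF bounded_linear_inner_left Ck_on_Suc_has_derivative[OF f1 that]])
    then have D1: "frechet_derivative f (at x) w \<bullet> e = frechet_derivative (\<lambda>x. f x \<bullet> e) (at x) w" if "x \<in> S" for x w
      using frechet_derivative_at that by metis
    have "((\<lambda>x. frechet_derivative f (at x) u) has_derivative frechet_derivative (\<lambda>x. frechet_derivative f (at x) u) (at p)) (at p)"
      using f1 p by (intro Ck_on_Suc_has_derivative[of 0 S]) auto
    from bounded_linear.has_derivative[OF bounded_linear_inner_left this, of e]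
    have "((\<lambda>x. frechet_derivative (\<lambda>x. f x \<bullet> e) (at x) u) has_derivative
        (\<lambda>w. frechet_derivative (\<lambda>x. frechet_derivative f (at x) u) (at p) w \<bullet> e)) (at p)"
      by (rule has_derivative_transform_within_open[OF _ S p D1])
    from frechet_derivative_at[OF this] show ?thesis by metis
  qed
  have "frechet_derivative (\<lambda>x. frechet_derivative f (at x) u) (at p) v \<bullet> e
    = frechet_derivative (\<lambda>x. frechet_derivative f (at x) v) (at p) u \<bullet> e" for e
    unfolding *[symmetric]
    by (rule frechet_derivative_commute_real[OF S Ck_on_bounded_linear[OF bounded_linear_inner_left S f] p])
  then show ?thesis by (metis vector_eq_ldot inner_commute)
qed

section \<open>Charts and tangent vectors\<close>

lemma chartD:
  assumes "is_chart (U, \<phi>)"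
  shows "open U" "open (\<phi> ` U)" "continuous_on U \<phi>" "continuous_on (\<phi> ` U) (inv_into U \<phi>)"
    and "p \<in> U \<Longrightarrow> inv_into U \<phi> (\<phi> p) = p"
  using assms unfolding is_chart_def homeomorphism_def by auto

lemma chart_inv:
  assumes "x \<in> \<phi> ` U"
  shows "\<phi> (inv_into U \<phi> x) = x" "inv_into U \<phi> x \<in> U"
  using assms by (auto intro: f_inv_into_f inv_into_into)

lemma chart_image_Int:
  assumes "is_chart (U, \<phi>)"
  shows "\<phi> ` (U \<inter> S) = {x \<in> \<phi> ` U. inv_into U \<phi> x \<in> S}"
  using chartD(5)[OF assms] by (auto simp: chart_inv intro!: rev_image_eqI)

lemma chart_image_open:
  assumes c: "is_chart (U, \<phi>)" and S: "open S"
  shows "open (\<phi> ` (U \<inter> S))"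
  using continuous_open_preimage[OF chartD(4)[OF c] chartD(2)[OF c] S]
  unfolding chart_image_Int[OF c] by (simp add: vimage_def Int_def)

section \<open>Smoothness near a point\<close>

text \<open>Isolates what the lemmas on \<open>smooth_near\<close> take from an atlas, so that they
  serve both \<open>A\<close> and \<open>vector_atlas\<close>.\<close>

definition charts_cover :: "('m::topological_space, 'e::real_normed_vector) chart set \<Rightarrow> bool" where
  "charts_cover A \<longleftrightarrow> (\<forall>c\<in>A. is_chart c) \<and> (\<Union>c\<in>A. fst c) = UNIV"

lemma charts_coverD:
  assumes "charts_cover A"
  shows "(U, \<phi>) \<in> A \<Longrightarrow> is_chart (U, \<phi>)"
    and "\<exists>U \<phi>. (U, \<phi>) \<in> A \<and> p \<in> U"
proof -
  show "(U, \<phi>) \<in> A \<Longrightarrow> is_chart (U, \<phi>)" using assms by (auto simp: charts_cover_def)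
  have "p \<in> (\<Union>c\<in>A. fst c)" using assms by (simp add: charts_cover_def)
  then show "\<exists>U \<phi>. (U, \<phi>) \<in> A \<and> p \<in> U" by force
qed

lemma charts_cover_smooth_atlas: "smooth_atlas A \<Longrightarrow> charts_cover A"
  by (simp add: smooth_atlas_def charts_cover_def)

lemma charts_cover_vector_atlas: "charts_cover (vector_atlas :: ('e::real_normed_vector, 'e) chart set)"
proof -
  have "is_chart (UNIV, id :: 'e \<Rightarrow> 'e)"
    by (auto simp: is_chart_def homeomorphism_def)
  then show ?thesis by (simp add: charts_cover_def vector_atlas_def)
qed

lemma smooth_map_on_chart:
  assumes "smooth_map_on A B S F" "(U, \<phi>) \<in> A" "(V, \<psi>) \<in> B"
  shows "Ck_on k (\<phi> ` (U \<inter> S \<inter> F -` V)) (\<lambda>x. \<psi> (F (inv_into U \<phi> x)))"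
  using assms unfolding smooth_map_on_def smooth_on_def o_def by fast

text \<open>The continuity demanded by \<open>smooth_map_on\<close> is the case \<open>k = 0\<close>
  in each chart, glued over the open sets \<open>U \<inter> S\<close>.\<close>

lemma smooth_near_iff:
  assumes A: "charts_cover A"
  shows "smooth_near A p f \<longleftrightarrow>
    (\<exists>S. open S \<and> p \<in> S \<and> (\<forall>U \<phi> k. (U, \<phi>) \<in> A \<longrightarrow> Ck_on k (\<phi> ` (U \<inter> S)) (\<lambda>x. f (inv_into U \<phi> x))))"
    (is "_ \<longleftrightarrow> ?R")
proof
  assume "smooth_near A p f"
  then obtain S where S: "open S" "p \<in> S" "smooth_map_on A vector_atlas S f"
    by (auto simp: smooth_near_def)
  then show ?R using smooth_map_on_chart[OF S(3), of _ _ UNIV id] by (auto simp: vector_atlas_def intro!: exI[of _ S])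
next
  assume ?R
  then obtain S where S: "open S" "p \<in> S" and
    Ck: "\<And>U \<phi> k. (U, \<phi>) \<in> A \<Longrightarrow> Ck_on k (\<phi> ` (U \<inter> S)) (\<lambda>x. f (inv_into U \<phi> x))" by auto
  have "continuous_on S f"
  proof -
    have "continuous_on (U \<inter> S) f" if U: "(U, \<phi>) \<in> A" for U \<phi>
    proof -
      note c = chartD[OF charts_coverD(1)[OF A U]]
      have "continuous_on (\<phi> ` (U \<inter> S)) (\<lambda>x. f (inv_into U \<phi> x))" using Ck[OF U, of 0] by simp
      then have "continuous_on (U \<inter> S) (\<lambda>p. f (inv_into U \<phi> (\<phi> p)))"
        by (rule continuous_on_compose2) (auto intro: continuous_on_subset[OF c(3)])
      then show ?thesis by (rule continuous_on_eq) (simp add: c(5))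
    qed
    moreover have "open (U \<inter> S)" if "(U, \<phi>) \<in> A" for U \<phi>
      using chartD(1)[OF charts_coverD(1)[OF A that]] S(1) by auto
    ultimately have "continuous_on (\<Union>((\<lambda>c. fst c \<inter> S) ` A)) f"
      by (intro continuous_on_open_Union) auto
    moreover have "(\<Union>((\<lambda>c. fst c \<inter> S) ` A)) = S" using charts_coverD(2)[OF A] by fastforce
    ultimately show ?thesis by simp
  qed
  moreover have "smooth_on (\<phi> ` (U \<inter> S \<inter> f -` V)) (\<psi> \<circ> f \<circ> inv_into U \<phi>)"
    if "(U, \<phi>) \<in> A" "(V, \<psi>) \<in> vector_atlas" for U \<phi> V \<psi>
    using Ck[OF that(1)] that(2) by (auto simp: smooth_on_def vector_atlas_def o_def)
  ultimately have "smooth_map_on A vector_atlas S f" by (auto simp: smooth_map_on_def)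
  then show "smooth_near A p f" using S by (auto simp: smooth_near_def)
qed

lemma smooth_nearE:
  assumes A: "charts_cover A" and f: "smooth_near A p f" and U: "(U, \<phi>) \<in> A" "p \<in> U"
  obtains T where "open T" "\<phi> p \<in> T" "T \<subseteq> \<phi> ` U" "\<And>k. Ck_on k T (\<lambda>x. f (inv_into U \<phi> x))"
proof -
  obtain S where "open S" "p \<in> S" "\<And>k. Ck_on k (\<phi> ` (U \<inter> S)) (\<lambda>x. f (inv_into U \<phi> x))"
    using f U(1) unfolding smooth_near_iff[OF A] by fast
  then show ?thesis
    using chart_image_open[OF charts_coverD(1)[OF A U(1)]] U(2) by (intro that[of "\<phi> ` (U \<inter> S)"]) auto
qed

lemma smooth_near_vector_atlas_iff:
  "smooth_near vector_atlas x f \<longleftrightarrow> (\<exists>S. open S \<and> x \<in> S \<and> (\<forall>k. Ck_on k S f))"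
  unfolding smooth_near_iff[OF charts_cover_vector_atlas] by (simp add: vector_atlas_def)

lemma smooth_near_combine:
  fixes A :: "('m::topological_space, 'e::real_normed_vector) chart set"
  assumes A: "charts_cover A" and fg: "smooth_near A p f" "smooth_near A p g"
    and comb: "\<And>(S :: 'e set) k u v. \<lbrakk>open S; Ck_on k S u; Ck_on k S v\<rbrakk> \<Longrightarrow> Ck_on k S (\<lambda>x. h (u x) (v x))"
  shows "smooth_near A p (\<lambda>x. h (f x) (g x))"
proof -
  obtain S where S: "open S" "p \<in> S" and
    f: "\<And>U \<phi> k. (U, \<phi>) \<in> A \<Longrightarrow> Ck_on k (\<phi> ` (U \<inter> S)) (\<lambda>x. f (inv_into U \<phi> x))"
    using fg(1) unfolding smooth_near_iff[OF A] by fast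
  obtain T where T: "open T" "p \<in> T" and
    g: "\<And>U \<phi> k. (U, \<phi>) \<in> A \<Longrightarrow> Ck_on k (\<phi> ` (U \<inter> T)) (\<lambda>x. g (inv_into U \<phi> x))"
    using fg(2) unfolding smooth_near_iff[OF A] by fast
  have "Ck_on k (\<phi> ` (U \<inter> (S \<inter> T))) (\<lambda>x. h (f (inv_into U \<phi> x)) (g (inv_into U \<phi> x)))"
    if "(U, \<phi>) \<in> A" for U \<phi> k
    using S(1) T(1)
    by (intro comb chart_image_open[OF charts_coverD(1)[OF A that]] open_Int
        Ck_on_subset[OF f[OF that]] Ck_on_subset[OF g[OF that]]) auto
  then show ?thesis unfolding smooth_near_iff[OF A] using S T by (intro exI[of _ "S \<inter> T"]) auto
qed

lemma smooth_near_lincomb: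
  assumes A: "charts_cover A" and fg: "smooth_near A p f" "smooth_near A p g"
  shows "smooth_near A p (\<lambda>x. a * f x + b * g x)"
  by (rule smooth_near_combine[OF A fg, of "\<lambda>x y. a * x + b * y"])
    (intro Ck_on_add Ck_on_bounded_linear[OF bounded_linear_mult_right])

lemma smooth_near_mult:
  assumes A: "charts_cover A" and fg: "smooth_near A p f" "smooth_near A p g"
  shows "smooth_near A p (\<lambda>x. f x * g x)"
  by (rule smooth_near_combine[OF A fg, of "\<lambda>x y. x * y"])
    (intro Ck_on_bounded_bilinear[OF bounded_bilinear_mult])

section \<open>Tangent vectors in coordinates\<close>

text \<open>The tangent vector at \<open>p\<close> whose coordinate vector in the chart
  \<open>c\<close> is \<open>w\<close>; the value \<open>0\<close> elsewhere is the convention of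
  \<open>tangent_space\<close>.\<close>

definition chart_derivation ::
    "('m::topological_space, 'e::real_normed_vector) chart set \<Rightarrow> ('m, 'e) chart \<Rightarrow> 'm \<Rightarrow> 'e \<Rightarrow> ('m \<Rightarrow> real) \<Rightarrow> real" where
  "chart_derivation A c p w = (\<lambda>f. if smooth_near A p f
     then frechet_derivative (\<lambda>x. f (inv_into (fst c) (snd c) x)) (at (snd c p)) w else 0)"

lemma smooth_near_has_derivative:
  assumes A: "charts_cover A" and f: "smooth_near A p f" and U: "(U, \<phi>) \<in> A" "p \<in> U"
  shows "((\<lambda>x. f (inv_into U \<phi> x)) has_derivative (\<lambda>w. chart_derivation A (U, \<phi>) p w f)) (at (\<phi> p))"
proof -
  obtain T where "open T" "\<phi> p \<in> T" "\<And>k. Ck_on k T (\<lambda>x. f (inv_into U \<phi> x))"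
    using smooth_nearE[OF A f U] by metis
  then have "((\<lambda>x. f (inv_into U \<phi> x)) has_derivative frechet_derivative (\<lambda>x. f (inv_into U \<phi> x)) (at (\<phi> p))) (at (\<phi> p))"
    by (intro Ck_on_Suc_has_derivative)
  then show ?thesis using f by (simp add: chart_derivation_def)
qed

lemma chart_derivation_eqI:
  assumes A: "charts_cover A" and f: "smooth_near A p f" and U: "(U, \<phi>) \<in> A" "p \<in> U"
    and der: "((\<lambda>x. f (inv_into U \<phi> x)) has_derivative D) (at (\<phi> p))"
  shows "chart_derivation A (U, \<phi>) p w f = D w"
  using has_derivative_unique[OF smooth_near_has_derivative[OF A f U] der] by metis

text \<open>The Leibniz rule is the product rule in the chart. With the surjectivity of
  \<open>\<iota>\<close> this makes every coordinate vector the image of a Lie algebra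
  element.\<close>

lemma chart_derivation_in_tangent_space:
  assumes A: "charts_cover A" and U: "(U, \<phi>) \<in> A" "p \<in> U"
  shows "chart_derivation A (U, \<phi>) p w \<in> tangent_space A p"
proof -
  let ?D = "chart_derivation A (U, \<phi>) p w"
  note der = smooth_near_has_derivative[OF A _ U] and eqI = chart_derivation_eqI[OF A _ U]
  have p: "inv_into U \<phi> (\<phi> p) = p" using chartD(5)[OF charts_coverD(1)[OF A U(1)] U(2)] .
  have "?D (\<lambda>x. a * f x + b * g x) = a * ?D f + b * ?D g" if fg: "smooth_near A p f" "smooth_near A p g" for f g a b
    by (rule eqI[OF smooth_near_lincomb[OF A fg]]) (intro derivative_intros der fg)
  moreover have "?D (\<lambda>x. f x * g x) = f p * ?D g + g p * ?D f" if fg: "smooth_near A p f" "smooth_near A p g" for f g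
    using eqI[OF smooth_near_mult[OF A fg] has_derivative_mult[OF der[OF fg(1)] der[OF fg(2)]], of w]
    by (simp add: p mult.commute)
  ultimately show ?thesis by (auto simp: tangent_space_def chart_derivation_def)
qed

section \<open>Lie groups in a chart at the identity\<close>

locale lie_group_chart = group G
  for G :: "'g::{t2_space,second_countable_topology} monoid" (structure) +
  fixes A :: "('g, 'l::real_inner) chart set" and U :: "'g set" and \<phi> :: "'g \<Rightarrow> 'l"
  assumes lie_group: "lie_group G A"
    and finite_dim: "finite_dimensional_UNIV TYPE('l)"
    and chart: "(U, \<phi>) \<in> A"
    and one_in_chart: "\<one> \<in> U"
begin

abbreviation "\<psi> \<equiv> inv_into U \<phi>"
abbreviation "x0 \<equiv> \<phi> \<one>"

lemma carrier_UNIV [simp]: "x \<in> carrier G"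
  using lie_group by (simp add: lie_group_def)

lemma atlas: "charts_cover A"
  using lie_group by (simp add: lie_group_def charts_cover_smooth_atlas)

lemmas chart_of_atlas = charts_coverD(1)[OF atlas]
lemmas chart_facts = chartD[OF chart_of_atlas[OF chart]]

lemma continuous_mult:
  assumes "continuous_on S f" "continuous_on S g"
  shows "continuous_on S (\<lambda>x. f x \<otimes> g x)"
proof -
  have "continuous_on UNIV (\<lambda>(x, y). x \<otimes> y)"
    using lie_group by (simp add: lie_group_def smooth_map_on_def)
  from continuous_on_compose2[OF this continuous_on_Pair[OF assms]] show ?thesis by simp
qed

lemma continuous_m_inv:
  assumes "continuous_on S f"
  shows "continuous_on S (\<lambda>x. inv (f x))"
proof -
  have "continuous_on UNIV (\<lambda>x. inv x)"
    using lie_group by (simp add: lie_group_def smooth_map_on_def)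
  from continuous_on_compose2[OF this assms] show ?thesis by simp
qed

section \<open>Multiplication and left-invariant fields in coordinates\<close>

text \<open>Three charts are kept separate because smoothness near the identity is tested in every
  chart of \<open>A\<close>, not only in \<open>(U, \<phi>)\<close>.\<close>

definition coord_dom :: "('g, 'l) chart \<Rightarrow> ('g, 'l) chart \<Rightarrow> ('g, 'l) chart \<Rightarrow> ('l \<times> 'l) set" where
  "coord_dom = (\<lambda>(U1, \<phi>1) (U2, \<phi>2) (U3, \<phi>3). {z \<in> \<phi>1 ` U1 \<times> \<phi>2 ` U2.
     inv_into U1 \<phi>1 (fst z) \<otimes> inv_into U2 \<phi>2 (snd z) \<in> U3})"

definition coord_mult :: "('g, 'l) chart \<Rightarrow> ('g, 'l) chart \<Rightarrow> ('g, 'l) chart \<Rightarrow> 'l \<times> 'l \<Rightarrow> 'l" where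
  "coord_mult = (\<lambda>(U1, \<phi>1) (U2, \<phi>2) (U3, \<phi>3) z.
     \<phi>3 (inv_into U1 \<phi>1 (fst z) \<otimes> inv_into U2 \<phi>2 (snd z)))"

lemma coord_mult_smooth:
  assumes "c1 \<in> A" "c2 \<in> A" "c3 \<in> A"
  shows "open (coord_dom c1 c2 c3)" "Ck_on k (coord_dom c1 c2 c3) (coord_mult c1 c2 c3)"
proof -
  obtain U1 \<phi>1 U2 \<phi>2 U3 \<phi>3 where c: "c1 = (U1, \<phi>1)" "c2 = (U2, \<phi>2)" "c3 = (U3, \<phi>3)"
    by (metis surj_pair)
  note A = assms[unfolded c]
  note f1 = chartD[OF chart_of_atlas[OF A(1)]] and f2 = chartD[OF chart_of_atlas[OF A(2)]]
    and f3 = chartD[OF chart_of_atlas[OF A(3)]]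
  let ?W = "\<phi>1 ` U1 \<times> \<phi>2 ` U2"
  have "continuous_on ?W (\<lambda>z. inv_into U1 \<phi>1 (fst z) \<otimes> inv_into U2 \<phi>2 (snd z))"
    by (intro continuous_mult continuous_on_compose2[OF f1(4)] continuous_on_compose2[OF f2(4)]
        continuous_on_fst continuous_on_snd continuous_on_id) auto
  then show op: "open (coord_dom c1 c2 c3)"
    using continuous_open_preimage[OF _ open_Times[OF f1(2) f2(2)] f3(1)]
    by (simp add: coord_dom_def c vimage_def Int_def)
  have inj: "inj_on (map_prod \<phi>1 \<phi>2) (U1 \<times> U2)"
    by (rule inj_onI) (auto, metis f1(5), metis f2(5))
  \<comment> \<open>Smoothness of the multiplication is given through the inverse of a product
    chart; on its image this is the pair of the two inverses.\<close>
  have inv: "inv_into (U1 \<times> U2) (map_prod \<phi>1 \<phi>2) z = (inv_into U1 \<phi>1 (fst z), inv_into U2 \<phi>2 (snd z))"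
    if "z \<in> ?W" for z
    by (rule inv_into_f_eq[OF inj]) (use that in \<open>auto simp: chart_inv f1(5) f2(5)\<close>)
  have "map_prod \<phi>1 \<phi>2 ` (U1 \<times> U2 \<inter> UNIV \<inter> (\<lambda>(x, y). x \<otimes> y) -` U3) = coord_dom c1 c2 c3"
    by (auto simp: coord_dom_def c f1(5) f2(5) chart_inv intro!: rev_image_eqI)
  moreover have "(U1 \<times> U2, map_prod \<phi>1 \<phi>2) \<in> prod_atlas A A"
    using A by (auto simp: prod_atlas_def)
  moreover have "smooth_map_on (prod_atlas A A) A UNIV (\<lambda>(x, y). x \<otimes> y)"
    using lie_group by (simp add: lie_group_def)
  ultimately have "Ck_on k (coord_dom c1 c2 c3)
      (\<lambda>z. \<phi>3 ((\<lambda>(x, y). x \<otimes> y) (inv_into (U1 \<times> U2) (map_prod \<phi>1 \<phi>2) z)))"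
    using smooth_map_on_chart[OF _ _ A(3)] by metis
  then show "Ck_on k (coord_dom c1 c2 c3) (coord_mult c1 c2 c3)"
    by (rule Ck_on_cong[OF op, rotated]) (simp add: coord_dom_def coord_mult_def c inv split_beta)
qed

abbreviation "M \<equiv> coord_mult (U, \<phi>) (U, \<phi>) (U, \<phi>)"
abbreviation "W \<equiv> coord_dom (U, \<phi>) (U, \<phi>) (U, \<phi>)"
abbreviation "D \<equiv> chart_derivation A (U, \<phi>) \<one>"

lemma in_W_iff: "(\<phi> p, \<phi> r) \<in> W \<longleftrightarrow> p \<otimes> r \<in> U" if "p \<in> U" "r \<in> U"
  using that by (simp add: coord_dom_def chart_facts(5))

lemma M_phi: "p \<in> U \<Longrightarrow> r \<in> U \<Longrightarrow> M (\<phi> p, \<phi> r) = \<phi> (p \<otimes> r)"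
  by (simp add: coord_mult_def chart_facts(5))

lemma x0_W: "(x0, x0) \<in> W"
  using one_in_chart by (simp add: in_W_iff)

text \<open>These are the test functions for the bracket; they are smooth because transition maps
  are.\<close>

lemma smooth_near_coordinate:
  assumes "p \<in> U"
  shows "smooth_near A p (\<lambda>p. \<phi> p \<bullet> e)"
proof -
  have "Ck_on k (\<phi>' ` (U' \<inter> U)) (\<lambda>x. \<phi> (inv_into U' \<phi>' x) \<bullet> e)" if c: "(U', \<phi>') \<in> A" for U' \<phi>' k
  proof (rule Ck_on_bounded_linear[OF bounded_linear_inner_left])
    show "open (\<phi>' ` (U' \<inter> U))" by (rule chart_image_open[OF chart_of_atlas[OF c] chart_facts(1)])
    have "smooth_atlas A" using lie_group by (simp add: lie_group_def)
    then show "Ck_on k (\<phi>' ` (U' \<inter> U)) (\<lambda>x. \<phi> (inv_into U' \<phi>' x))"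
      using c chart unfolding smooth_atlas_def smooth_on_def o_def by fast
  qed
  then show ?thesis using assms chart_facts(1) unfolding smooth_near_iff[OF atlas] by blast
qed

text \<open>Coordinates recover the vector, so a vector whose derivation vanishes is zero.\<close>

lemma D_coordinate: "D w (\<lambda>p. \<phi> p \<bullet> e) = w \<bullet> e"
proof (rule chart_derivation_eqI[OF atlas smooth_near_coordinate[OF one_in_chart] chart one_in_chart])
  have "((\<lambda>x. x \<bullet> e) has_derivative (\<lambda>x. x \<bullet> e)) (at x0)"
    by (rule bounded_linear_imp_has_derivative[OF bounded_linear_inner_left])
  then show "((\<lambda>x. \<phi> (\<psi> x) \<bullet> e) has_derivative (\<lambda>x. x \<bullet> e)) (at x0)"
    by (rule has_derivative_transform_within_open[OF _ chart_facts(2)])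
      (auto simp: one_in_chart chart_inv)
qed

lemma smooth_near_coordinate_translate:
  assumes p: "p \<in> U"
  shows "smooth_near A \<one> (\<lambda>x. \<phi> (p \<otimes> x) \<bullet> e)"
proof -
  let ?S = "{x. p \<otimes> x \<in> U}"
  have S: "open ?S"
    using continuous_open_preimage[OF continuous_mult[OF continuous_on_const continuous_on_id] open_UNIV chart_facts(1), of p]
    by (simp add: vimage_def)
  have "Ck_on k (\<phi>' ` (U' \<inter> ?S)) (\<lambda>x. \<phi> (p \<otimes> inv_into U' \<phi>' x) \<bullet> e)" if c: "(U', \<phi>') \<in> A" for U' \<phi>' k
  proof (rule Ck_on_bounded_linear[OF bounded_linear_inner_left])
    show op: "open (\<phi>' ` (U' \<inter> ?S))" by (rule chart_image_open[OF chart_of_atlas[OF c] S])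
    have "Ck_on k (\<phi>' ` (U' \<inter> ?S)) (\<lambda>x. coord_mult (U, \<phi>) (U', \<phi>') (U, \<phi>) ((0, x) + (\<phi> p, 0)))"
      by (rule Ck_on_affine[OF _ coord_mult_smooth(1)[OF chart c chart] op _ coord_mult_smooth(2)[OF chart c chart]])
        (auto simp: coord_dom_def p chart_facts(5) chartD(5)[OF chart_of_atlas[OF c]]
          intro!: bounded_linear_Pair bounded_linear_zero bounded_linear_ident)
    then show "Ck_on k (\<phi>' ` (U' \<inter> ?S)) (\<lambda>x. \<phi> (p \<otimes> inv_into U' \<phi>' x))"
      by (simp add: coord_mult_def p chart_facts(5))
  qed
  then show ?thesis using one_in_chart p S unfolding smooth_near_iff[OF atlas] by (intro exI[of _ ?S]) auto
qed

text \<open>The left side is the left-invariant field of \<open>D w\<close> at \<open>p\<close>,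
  applied to a coordinate. In coordinates this field is the partial derivative of the multiplication
  in its second argument at the identity.\<close>

lemma D_coordinate_translate:
  assumes c: "(U', \<phi>') \<in> A" and p: "p \<in> U" "p \<in> U'"
  shows "D w (\<lambda>x. \<phi> (p \<otimes> x) \<bullet> e)
    = frechet_derivative (coord_mult (U', \<phi>') (U, \<phi>) (U, \<phi>)) (at (\<phi>' p, x0)) (0, w) \<bullet> e"
proof (rule chart_derivation_eqI[OF atlas smooth_near_coordinate_translate[OF p(1)] chart one_in_chart])
  let ?M = "coord_mult (U', \<phi>') (U, \<phi>) (U, \<phi>)"
  have p': "inv_into U' \<phi>' (\<phi>' p) = p" using chartD(5)[OF chart_of_atlas[OF c] p(2)] .
  have "(\<phi>' p, x0) \<in> coord_dom (U', \<phi>') (U, \<phi>) (U, \<phi>)"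
    using p p' one_in_chart by (simp add: coord_dom_def chart_facts(5))
  then have M: "(?M has_derivative frechet_derivative ?M (at (\<phi>' p, x0))) (at (\<phi>' p, x0))"
    using coord_mult_smooth(2)[OF c chart chart] by (rule Ck_on_Suc_has_derivative[rotated])
  have "((\<lambda>x. (\<phi>' p, x)) has_derivative (\<lambda>w. (0, w))) (at x0)"
    by (auto intro!: derivative_eq_intros)
  from bounded_linear.has_derivative[OF bounded_linear_inner_left has_derivative_compose[OF this M]]
  show "((\<lambda>x. \<phi> (p \<otimes> \<psi> x) \<bullet> e) has_derivative (\<lambda>w. frechet_derivative ?M (at (\<phi>' p, x0)) (0, w) \<bullet> e)) (at x0)"
    by (simp add: coord_mult_def p')
qed

lemma Ck_on_partial_slice:
  assumes c: "(U', \<phi>') \<in> A"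
  shows "Ck_on k (\<phi>' ` (U' \<inter> U)) (\<lambda>x. frechet_derivative (coord_mult (U', \<phi>') (U, \<phi>) (U, \<phi>)) (at (x, x0)) (0, w))"
proof -
  let ?M = "coord_mult (U', \<phi>') (U, \<phi>) (U, \<phi>)" and ?W = "coord_dom (U', \<phi>') (U, \<phi>) (U, \<phi>)"
  have op: "open (\<phi>' ` (U' \<inter> U))" by (rule chart_image_open[OF chart_of_atlas[OF c] chart_facts(1)])
  have "Ck_on k ?W (\<lambda>z. frechet_derivative ?M (at z) (0, w))"
    using coord_mult_smooth(2)[OF c chart chart, of "Suc k"] by simp
  moreover have "bounded_linear (\<lambda>x::'l. (x, 0::'l))"
    by (intro bounded_linear_Pair bounded_linear_zero bounded_linear_ident)
  moreover have "(x, 0) + (0, x0) \<in> ?W" if "x \<in> \<phi>' ` (U' \<inter> U)" for x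
    using that by (auto simp: coord_dom_def one_in_chart chart_facts(5) chartD(5)[OF chart_of_atlas[OF c]])
  ultimately show ?thesis
    using Ck_on_affine[OF _ coord_mult_smooth(1)[OF c chart chart] op, of "\<lambda>x. (x, 0)" "(0, x0)"] by simp
qed

text \<open>One of the two terms of the Lie bracket on a coordinate function: differentiating the
  left-invariant field along \<open>u\<close> gives a mixed second derivative of
  \<open>M\<close>.\<close>

lemma D_D_coordinate:
  shows "smooth_near A \<one> (\<lambda>p. D w (\<lambda>x. \<phi> (p \<otimes> x) \<bullet> e))"
    and "D u (\<lambda>p. D w (\<lambda>x. \<phi> (p \<otimes> x) \<bullet> e))
      = frechet_derivative (\<lambda>z. frechet_derivative M (at z) (0, w)) (at (x0, x0)) (u, 0) \<bullet> e"
proof -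
  let ?F = "\<lambda>p. D w (\<lambda>x. \<phi> (p \<otimes> x) \<bullet> e)"
  have "Ck_on k (\<phi>' ` (U' \<inter> U)) (\<lambda>x. ?F (inv_into U' \<phi>' x))" if c: "(U', \<phi>') \<in> A" for U' \<phi>' k
  proof (rule Ck_on_cong)
    show "Ck_on k (\<phi>' ` (U' \<inter> U)) (\<lambda>x. frechet_derivative (coord_mult (U', \<phi>') (U, \<phi>) (U, \<phi>)) (at (x, x0)) (0, w) \<bullet> e)"
      by (intro Ck_on_bounded_linear[OF bounded_linear_inner_left] Ck_on_partial_slice c
          chart_image_open[OF chart_of_atlas[OF c] chart_facts(1)])
    show "open (\<phi>' ` (U' \<inter> U))" by (rule chart_image_open[OF chart_of_atlas[OF c] chart_facts(1)])
  qed (auto simp: D_coordinate_translate[OF c] chartD(5)[OF chart_of_atlas[OF c]])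
  then show F: "smooth_near A \<one> ?F"
    using one_in_chart chart_facts(1) unfolding smooth_near_iff[OF atlas] by blast
  have "((\<lambda>z. frechet_derivative M (at z) (0, w)) has_derivative
      frechet_derivative (\<lambda>z. frechet_derivative M (at z) (0, w)) (at (x0, x0))) (at (x0, x0))"
    using coord_mult_smooth(2)[OF chart chart chart, of 2] x0_W
    by (intro Ck_on_Suc_has_derivative[of 0 W]) (auto simp: numeral_2_eq_2)
  moreover have "((\<lambda>x. (x, x0)) has_derivative (\<lambda>u. (u, 0))) (at x0)"
    by (auto intro!: derivative_eq_intros)
  ultimately have "((\<lambda>x. frechet_derivative M (at (x, x0)) (0, w)) has_derivative
      (\<lambda>u. frechet_derivative (\<lambda>z. frechet_derivative M (at z) (0, w)) (at (x0, x0)) (u, 0))) (at x0)"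
    by (rule has_derivative_compose[rotated])
  from bounded_linear.has_derivative[OF bounded_linear_inner_left this, of e]
  have "((\<lambda>x. ?F (\<psi> x)) has_derivative
      (\<lambda>u. frechet_derivative (\<lambda>z. frechet_derivative M (at z) (0, w)) (at (x0, x0)) (u, 0) \<bullet> e)) (at x0)"
    by (rule has_derivative_transform_within_open[OF _ chart_facts(2)])
      (auto simp: D_coordinate_translate[OF chart] one_in_chart chart_facts(5))
  then show "D u ?F = frechet_derivative (\<lambda>z. frechet_derivative M (at z) (0, w)) (at (x0, x0)) (u, 0) \<bullet> e"
    by (rule chart_derivation_eqI[OF atlas F chart one_in_chart])
qed

text \<open>In coordinates the bracket is the difference of the two sides, and the functions
  \<open>\<phi> p \<bullet> e\<close> detect every component.\<close>

lemma tangent_bracket_zero_imp: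
  assumes "\<And>f. tangent_bracket G A (D u) (D w) f = 0"
  shows "frechet_derivative (\<lambda>z. frechet_derivative M (at z) (0, w)) (at (x0, x0)) (u, 0)
    = frechet_derivative (\<lambda>z. frechet_derivative M (at z) (0, u)) (at (x0, x0)) (w, 0)" (is "?l = ?r")
proof -
  have "?l \<bullet> e = ?r \<bullet> e" for e
    using assms[of "\<lambda>p. \<phi> p \<bullet> e"] smooth_near_coordinate[OF one_in_chart]
    by (simp add: tangent_bracket_def left_invariant_field_def D_D_coordinate)
  then show ?thesis by (metis vector_eq_ldot inner_commute)
qed

section \<open>Derivatives of translations and of the inverse\<close>

abbreviation "DM z \<equiv> frechet_derivative M (at z)"

lemmas M_smooth = coord_mult_smooth[OF chart chart chart]

lemma M_deriv: "z \<in> W \<Longrightarrow> (M has_derivative DM z) (at z)"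
  using M_smooth(2) by (rule Ck_on_Suc_has_derivative)

lemma DM_deriv: "z \<in> W \<Longrightarrow> ((\<lambda>z. DM z v) has_derivative frechet_derivative (\<lambda>z. DM z v) (at z)) (at z)"
  using M_smooth(2)[of "Suc (Suc 0)"] unfolding Ck_on.simps(2)[of "Suc 0"]
  by (blast intro: Ck_on_Suc_has_derivative)

lemma linear_DM: "z \<in> W \<Longrightarrow> linear (DM z)"
  using M_deriv by (rule has_derivative_linear)

text \<open>Formulas in \<open>M\<close> hold only where all products stay in \<open>U\<close>; such
  points form an open set \<open>S\<close>, and the equality is checked on group elements rather
  than coordinates.\<close>

lemma has_derivative_near:
  assumes "(f has_derivative f') (at (\<phi> p))" "open S" "p \<in> U" "p \<in> S"
    and "\<And>q. \<lbrakk>q \<in> U; q \<in> S\<rbrakk> \<Longrightarrow> f (\<phi> q) = g (\<phi> q)"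
  shows "(g has_derivative f') (at (\<phi> p))"
proof (rule has_derivative_transform_within_open[OF assms(1)])
  show "open (\<phi> ` (U \<inter> S))" using chart_image_open[OF chart_of_atlas[OF chart] assms(2)] .
qed (use assms in auto)

lemma open_Collect_U: "continuous_on UNIV f \<Longrightarrow> open {q. f q \<in> U}"
  using continuous_open_preimage[OF _ open_UNIV chart_facts(1), of f] by (simp add: vimage_def)

text \<open>The two-sided translation is the slice of \<open>M\<close> at \<open>a\<close> in the
  first argument followed by the slice at \<open>b\<close> in the second; the hypotheses keep the
  products inside the chart.\<close>

lemma translate_has_derivative:
  assumes "a \<in> U" "b \<in> U" "r \<in> U" "a \<otimes> r \<in> U" "a \<otimes> r \<otimes> b \<in> U"
  shows "((\<lambda>x. \<phi> (a \<otimes> \<psi> x \<otimes> b)) has_derivative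
    (\<lambda>w. DM (\<phi> (a \<otimes> r), \<phi> b) (DM (\<phi> a, \<phi> r) (0, w), 0))) (at (\<phi> r))"
proof -
  have "(M has_derivative DM (\<phi> a, \<phi> r)) (at (\<phi> a, \<phi> r))"
    using assms by (intro M_deriv) (simp add: in_W_iff)
  moreover have "((\<lambda>x. (\<phi> a, x)) has_derivative (\<lambda>w. (0, w))) (at (\<phi> r))"
    by (auto intro!: derivative_eq_intros)
  ultimately have 1: "((\<lambda>x. M (\<phi> a, x)) has_derivative (\<lambda>w. DM (\<phi> a, \<phi> r) (0, w))) (at (\<phi> r))"
    by (rule has_derivative_compose[rotated])
  have "(M has_derivative DM (\<phi> (a \<otimes> r), \<phi> b)) (at (\<phi> (a \<otimes> r), \<phi> b))"
    using assms by (intro M_deriv) (simp add: in_W_iff)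
  moreover have "((\<lambda>x. (x, \<phi> b)) has_derivative (\<lambda>w. (w, 0))) (at (\<phi> (a \<otimes> r)))"
    by (auto intro!: derivative_eq_intros)
  ultimately have 2: "((\<lambda>x. M (x, \<phi> b)) has_derivative (\<lambda>w. DM (\<phi> (a \<otimes> r), \<phi> b) (w, 0))) (at (\<phi> (a \<otimes> r)))"
    by (rule has_derivative_compose[rotated])
  have "((\<lambda>x. M (M (\<phi> a, x), \<phi> b)) has_derivative
    (\<lambda>w. DM (\<phi> (a \<otimes> r), \<phi> b) (DM (\<phi> a, \<phi> r) (0, w), 0))) (at (\<phi> r))"
    using has_derivative_compose[OF 1, of "\<lambda>x. M (x, \<phi> b)"] 2 assms by (simp add: M_phi)
  moreover have "open {q. a \<otimes> q \<in> U}"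
    by (intro open_Collect_U continuous_mult continuous_on_const continuous_on_id)
  ultimately show ?thesis
    by (rule has_derivative_near) (use assms in \<open>simp_all add: M_phi chart_facts(5)\<close>)
qed

lemma M_one: "x \<in> \<phi> ` U \<Longrightarrow> M (x, x0) = x" "x \<in> \<phi> ` U \<Longrightarrow> M (x0, x) = x"
  using one_in_chart by (auto simp: M_phi)

lemma one_W: "p \<in> U \<Longrightarrow> (\<phi> p, x0) \<in> W" "p \<in> U \<Longrightarrow> (x0, \<phi> p) \<in> W"
  using one_in_chart by (auto simp: in_W_iff)

text \<open>Differentiates \<open>p \<otimes> \<one> = p\<close>. That it holds along the whole
  chart, not only at the identity, kills a second derivative in the computation of
  \<open>Ad\<close>.\<close>

lemma DM_one_right: assumes "p \<in> U" shows "DM (\<phi> p, x0) (w, 0) = w"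
proof -
  have "((\<lambda>x. (x, x0)) has_derivative (\<lambda>w. (w, 0))) (at (\<phi> p))"
    by (auto intro!: derivative_eq_intros)
  from has_derivative_compose[OF this M_deriv[OF one_W(1)[OF assms]]]
  have "((\<lambda>x. x) has_derivative (\<lambda>w. DM (\<phi> p, x0) (w, 0))) (at (\<phi> p))"
    by (rule has_derivative_near[OF _ open_UNIV assms]) (auto simp: M_one)
  from has_derivative_unique[OF this has_derivative_ident] show ?thesis by metis
qed

lemma DM_one_left: assumes "p \<in> U" shows "DM (x0, \<phi> p) (0, w) = w"
proof -
  have "((\<lambda>x. (x0, x)) has_derivative (\<lambda>w. (0, w))) (at (\<phi> p))"
    by (auto intro!: derivative_eq_intros)
  from has_derivative_compose[OF this M_deriv[OF one_W(2)[OF assms]]]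
  have "((\<lambda>x. x) has_derivative (\<lambda>w. DM (x0, \<phi> p) (0, w))) (at (\<phi> p))"
    by (rule has_derivative_near[OF _ open_UNIV assms]) (auto simp: M_one)
  from has_derivative_unique[OF this has_derivative_ident] show ?thesis by metis
qed

lemma DM_one: "DM (x0, x0) (v, w) = v + w"
  using linear_add[OF linear_DM[OF x0_W], of "(v, 0)" "(0, w)"]
  by (simp add: DM_one_left DM_one_right one_in_chart)

text \<open>Differentiating \<open>p \<otimes> inv p = \<one>\<close> at the identity, where the
  derivative of \<open>M\<close> is addition, gives \<open>w + I w = 0\<close>.\<close>

lemma inverse_has_derivative: "((\<lambda>x. \<phi> (inv (\<psi> x))) has_derivative (\<lambda>w. - w)) (at x0)"
proof -
  let ?S = "\<phi> ` (U \<inter> UNIV \<inter> (\<lambda>x. inv x) -` U)"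
  have "Ck_on (Suc 0) ?S (\<lambda>x. \<phi> (inv (\<psi> x)))"
    using lie_group smooth_map_on_chart[OF _ chart chart] unfolding lie_group_def by blast
  moreover have "x0 \<in> ?S" using one_in_chart by auto
  ultimately obtain I where I: "((\<lambda>x. \<phi> (inv (\<psi> x))) has_derivative I) (at x0)"
    using Ck_on_Suc_has_derivative by blast
  have "DM (x0, x0) = (\<lambda>w. fst w + snd w)" using DM_one by auto
  then have M: "(M has_derivative (\<lambda>w. fst w + snd w)) (at (x0, \<phi> (inv (\<psi> x0))))"
    using M_deriv[OF x0_W] by (simp add: chart_facts(5) one_in_chart)
  have "((\<lambda>x. M (x, \<phi> (inv (\<psi> x)))) has_derivative (\<lambda>w. w + I w)) (at x0)"
    using has_derivative_compose[OF has_derivative_Pair[OF has_derivative_ident I] M] by simp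
  then have "((\<lambda>x. x0) has_derivative (\<lambda>w. w + I w)) (at x0)"
    by (rule has_derivative_near[OF _ open_Collect_U[OF continuous_m_inv[OF continuous_on_id]]])
      (auto simp: one_in_chart chart_facts(5) M_phi)
  from has_derivative_unique[OF this has_derivative_const] have "w + I w = 0" for w by metis
  then have "I = (\<lambda>w. - w)" by (simp add: fun_eq_iff add_eq_0_iff)
  with I show ?thesis by simp
qed

text \<open>The centralizer of \<open>c\<close> is closed since the space is Hausdorff, and open
  since with \<open>q\<close> it contains the translate of \<open>S\<close> by
  \<open>q\<close>.\<close>

lemma commute_all_of_commute_nbhd:
  assumes conn: "connected (UNIV :: 'g set)"
    and S: "open S" "\<one> \<in> S" "\<And>p. p \<in> S \<Longrightarrow> c \<otimes> p = p \<otimes> c"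
  shows "c \<otimes> p = p \<otimes> c"
proof -
  let ?Z = "{p. c \<otimes> p = p \<otimes> c}"
  have "closed ?Z"
    by (intro closed_Collect_eq continuous_mult continuous_on_const continuous_on_id)
  moreover have "open ?Z"
  proof (subst open_subopen, intro ballI)
    fix q assume q: "q \<in> ?Z"
    let ?T = "{p. inv q \<otimes> p \<in> S}"
    have "open ?T"
      using continuous_open_preimage[OF continuous_mult[OF continuous_on_const continuous_on_id] open_UNIV S(1), of "inv q"]
      by (simp add: vimage_def)
    moreover have "q \<in> ?T" using S(2) by simp
    moreover have "?T \<subseteq> ?Z"
    proof
      fix p assume "p \<in> ?T"
      then have "c \<otimes> (inv q \<otimes> p) = (inv q \<otimes> p) \<otimes> c" using S(3) by simp
      then have "c \<otimes> (q \<otimes> (inv q \<otimes> p)) = (q \<otimes> (inv q \<otimes> p)) \<otimes> c" using q by (intro commute_mult[of c q "inv q \<otimes> p"]) auto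
      then show "p \<in> ?Z" by (simp add: mult_inv_cancel)
    qed
    ultimately show "\<exists>T. open T \<and> q \<in> T \<and> T \<subseteq> ?Z" by blast
  qed
  moreover have "\<one> \<in> ?Z" by simp
  ultimately have "?Z = UNIV" using conn unfolding connected_clopen by fastforce
  then show ?thesis by blast
qed

end

section \<open>One-parameter subgroups in the chart\<close>

locale lie_group_curve = lie_group_chart G A U \<phi>
  for G :: "'g::{t2_space,second_countable_topology} monoid" (structure)
    and A :: "('g, 'l::real_inner) chart set" and U \<phi> +
  fixes \<gamma> :: "real \<Rightarrow> 'g"
  assumes subgroup_curve: "one_parameter_subgroup G A \<gamma>"
begin

lemma curve_add: "\<gamma> (s + t) = \<gamma> s \<otimes> \<gamma> t"
  using subgroup_curve by (simp add: one_parameter_subgroup_def)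

lemma curve_zero [simp]: "\<gamma> 0 = \<one>"
proof -
  have "inv (\<gamma> 0) \<otimes> (\<gamma> 0 \<otimes> \<gamma> 0) = \<one>" using curve_add[of 0 0] by simp
  then show ?thesis by (simp add: mult_inv_cancel)
qed

lemma curve_uminus: "\<gamma> (- t) = inv (\<gamma> t)"
  using curve_add[of "- t" t] by (intro inv_equality[symmetric]) auto

lemma curve_continuous: "continuous_on UNIV \<gamma>"
  using subgroup_curve by (simp add: one_parameter_subgroup_def smooth_map_on_def)

lemma curve_dom_open: "open {t. \<gamma> t \<in> U}"
  using continuous_open_preimage[OF curve_continuous open_UNIV chart_facts(1)] by (simp add: vimage_def)

abbreviation "y t \<equiv> \<phi> (\<gamma> t)"
definition velocity where "velocity = frechet_derivative y (at 0) 1"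

lemma curve_Ck: "Ck_on k {t. \<gamma> t \<in> U} y"
proof -
  have "smooth_map_on vector_atlas A UNIV \<gamma>"
    using subgroup_curve by (simp add: one_parameter_subgroup_def)
  from smooth_map_on_chart[OF this _ chart, of UNIV id k]
  show ?thesis by (simp add: vector_atlas_def vimage_def)
qed

lemma curve_has_derivative: "(y has_derivative (\<lambda>r. r *\<^sub>R velocity)) (at 0)"
proof -
  have d: "(y has_derivative frechet_derivative y (at 0)) (at 0)"
    using curve_Ck by (rule Ck_on_Suc_has_derivative) (simp add: one_in_chart)
  have "frechet_derivative y (at 0) r = r *\<^sub>R velocity" for r
    using linear_cmul[OF has_derivative_linear[OF d], of r 1] by (simp add: velocity_def)
  with d show ?thesis by (metis (no_types, lifting) ext)
qed

text \<open>Turns the abstract initial tangent vector in \<open>exponential_map\<close> into a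
  coordinate vector, to which the formulas for \<open>M\<close> apply.\<close>

lemma curve_derivation: "differential A \<gamma> 0 (vector_tangent 0 1) = D velocity"
proof
  fix f
  show "differential A \<gamma> 0 (vector_tangent 0 1) f = D velocity f"
  proof (cases "smooth_near A \<one> f")
    case False
    then show ?thesis by (simp add: differential_def chart_derivation_def)
  next
    case True
    obtain T where T: "open T" "x0 \<in> T" "T \<subseteq> \<phi> ` U" "\<And>k. Ck_on k T (\<lambda>x. f (\<psi> x))"
      using smooth_nearE[OF atlas True chart one_in_chart] by metis
    define S where "S = {t. \<gamma> t \<in> U \<and> y t \<in> T}"
    have S: "open S" "0 \<in> S"
      using continuous_open_preimage[OF _ curve_dom_open T(1), of y] curve_Ck[of 0] T(2) one_in_chart
      by (simp_all add: S_def vimage_def Int_def)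
    \<comment> \<open>\<open>vector_tangent\<close> is \<open>0\<close> on functions that are not
      smooth near \<open>0\<close>, so smoothness of \<open>f \<circ> \<gamma>\<close> has to be
      secured before its derivative can be read off.\<close>
    have "Ck_on k S (\<lambda>t. f (\<psi> (y t)))" for k
      by (rule Ck_on_compose[OF finite_dim S(1) T(1) _ Ck_on_subset[OF curve_Ck] T(4)]) (auto simp: S_def)
    then have Ck: "Ck_on k S (f \<circ> \<gamma>)" for k
      by (rule Ck_on_cong[OF S(1), rotated]) (simp add: S_def chart_facts(5))
    then have near: "smooth_near vector_atlas 0 (f \<circ> \<gamma>)"
      using S unfolding smooth_near_vector_atlas_iff by blast
    have "((\<lambda>x. f (\<psi> x)) has_derivative (\<lambda>w. D w f)) (at (y 0))"
      using smooth_near_has_derivative[OF atlas True chart one_in_chart] by simp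
    from has_derivative_compose[OF curve_has_derivative this]
    have "((f \<circ> \<gamma>) has_derivative (\<lambda>r. D (r *\<^sub>R velocity) f)) (at 0)"
      by (rule has_derivative_transform_within_open[OF _ S]) (simp add: S_def chart_facts(5))
    from frechet_derivative_at[OF this]
    have "frechet_derivative (f \<circ> \<gamma>) (at 0) 1 = D velocity f" by (metis scaleR_one)
    then show ?thesis using True near by (simp add: differential_def vector_tangent_def)
  qed
qed

section \<open>The adjoint action along the curve\<close>

text \<open>The times at which conjugation by \<open>\<gamma> t\<close>, near the identity, can be
  written with \<open>M\<close>.\<close>

definition small :: "real \<Rightarrow> bool" where "small t \<longleftrightarrow> \<gamma> t \<in> U \<and> \<gamma> (- t) \<in> U"

lemma open_small: "open {t. small t}"
proof -
  have "continuous_on UNIV (\<lambda>t. \<gamma> (- t))"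
    by (intro continuous_on_compose2[OF curve_continuous] continuous_intros) auto
  from continuous_open_preimage[OF this open_UNIV chart_facts(1)] curve_dom_open
  show ?thesis by (simp add: small_def Collect_conj_eq open_Int vimage_def)
qed

lemma small_zero: "small 0"
  by (simp add: small_def one_in_chart)

lemma small_nbhd: obtains e where "e > 0" "\<And>t. \<bar>t\<bar> < e \<Longrightarrow> small t"
proof -
  obtain e where "e > 0" "ball 0 e \<subseteq> {t. small t}"
    using open_small small_zero unfolding open_contains_ball by blast
  then show ?thesis by (intro that[of e]) auto
qed

lemma curve_cancel [simp]: "\<gamma> t \<otimes> \<gamma> (- t) = \<one>"
  using curve_add[of t "- t"] by simp

text \<open>The chain rule for conjugation by \<open>\<gamma> t\<close> at the identity: left
  translation by \<open>\<gamma> t\<close>, then right translation by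
  \<open>\<gamma> (- t)\<close>.\<close>

definition Ad :: "real \<Rightarrow> 'l \<Rightarrow> 'l" where
  "Ad t w = DM (y t, y (- t)) (DM (y t, x0) (0, w), 0)"

lemma Ad_has_derivative:
  assumes "small t"
  shows "((\<lambda>x. \<phi> (\<gamma> t \<otimes> \<psi> x \<otimes> \<gamma> (- t))) has_derivative Ad t) (at x0)"
  using translate_has_derivative[of "\<gamma> t" "\<gamma> (- t)" \<one>] assms one_in_chart
  unfolding Ad_def[abs_def] by (simp add: small_def)

text \<open>Conjugation by \<open>\<gamma> (t + s)\<close> is a composition of two conjugations,
  each fixing the identity.\<close>

lemma Ad_add:
  assumes "small t" "small s" "small (t + s)"
  shows "Ad (t + s) w = Ad t (Ad s w)"
proof -
  have "((\<lambda>x. \<phi> (\<gamma> t \<otimes> \<psi> x \<otimes> \<gamma> (- t))) has_derivative Ad t) (at (\<phi> (\<gamma> s \<otimes> \<psi> x0 \<otimes> \<gamma> (- s))))"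
    using Ad_has_derivative[OF assms(1)] by (simp add: chart_facts(5) one_in_chart)
  from has_derivative_compose[OF Ad_has_derivative[OF assms(2)] this]
  have "((\<lambda>x. \<phi> (\<gamma> (t + s) \<otimes> \<psi> x \<otimes> \<gamma> (- (t + s)))) has_derivative (\<lambda>w. Ad t (Ad s w))) (at x0)"
  proof (rule has_derivative_near)
    show "open {q. \<gamma> s \<otimes> q \<otimes> \<gamma> (- s) \<in> U}"
      by (intro open_Collect_U continuous_mult continuous_on_const continuous_on_id)
    have "\<gamma> (- t - s) = \<gamma> (- s) \<otimes> \<gamma> (- t)"
      unfolding curve_add[symmetric] by (rule arg_cong[of _ _ \<gamma>]) simp
    then show "\<phi> (\<gamma> t \<otimes> \<psi> (\<phi> (\<gamma> s \<otimes> \<psi> (\<phi> q) \<otimes> \<gamma> (- s))) \<otimes> \<gamma> (- t)) = \<phi> (\<gamma> (t + s) \<otimes> \<psi> (\<phi> q) \<otimes> \<gamma> (- (t + s)))"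
      if "q \<in> U" "q \<in> {q. \<gamma> s \<otimes> q \<otimes> \<gamma> (- s) \<in> U}" for q
      using that by (simp add: chart_facts(5) curve_add m_assoc)
  qed (auto simp: one_in_chart)
  from has_derivative_unique[OF this Ad_has_derivative[OF assms(3)]] show ?thesis by metis
qed

lemma Ad_zero: "Ad 0 w = w"
  by (simp add: Ad_def DM_one)

text \<open>The derivative of \<open>Ad\<close> at \<open>0\<close> is the bracket with the velocity: in coordinates it is
  \<open>D\<^sub>1\<^sub>\<zeta> D\<^sub>2\<^sub>w M - D\<^sub>2\<^sub>\<zeta> D\<^sub>1\<^sub>w M\<close> at the identity, and the second-order derivatives commute.\<close>

lemma Ad_has_derivative_zero:
  assumes br: "\<And>w. frechet_derivative (\<lambda>z. DM z (0, w)) (at (x0, x0)) (velocity, 0)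
    = frechet_derivative (\<lambda>z. DM z (0, velocity)) (at (x0, x0)) (w, 0)"
  shows "((\<lambda>s. Ad s w) has_derivative (\<lambda>_. 0)) (at 0)"
proof -
  obtain B :: "'l set" where B: "finite B" "\<And>x. x = (\<Sum>b\<in>B. (x \<bullet> b / (b \<bullet> b)) *\<^sub>R b)"
    using finite_dimensional_coordinates[OF finite_dim] by blast
  define c where "c b x = x \<bullet> b / (b \<bullet> b)" for b x :: 'l
  have sum_c: "(\<Sum>b\<in>B. c b x *\<^sub>R b) = x" for x using B(2)[of x] by (simp add: c_def)
  have c_lin: "bounded_linear (c b)" for b
    unfolding c_def by (intro bounded_linear_compose[OF bounded_linear_divide bounded_linear_inner_left])
  define K where "K v = frechet_derivative (\<lambda>z. DM z v) (at (x0, x0))" for v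
  have K: "((\<lambda>z. DM z v) has_derivative K v) (at (x0, x0))" for v
    unfolding K_def by (rule DM_deriv[OF x0_W])
  have K_lin: "linear (K v)" for v using K by (rule has_derivative_linear)
  \<comment> \<open>In \<open>Ad s w\<close> both the base point and the direction
    \<open>u s\<close> move. Expanding the direction in \<open>B\<close> gives a finite sum of
    products, to which the product rule applies.\<close>
  have DM_sum: "DM z (x, 0) = (\<Sum>b\<in>B. c b x *\<^sub>R DM z (b, 0))" if "z \<in> W" for z x
  proof -
    have "(\<Sum>b\<in>B. c b x *\<^sub>R (b, 0 :: 'l)) = (x, 0)"
      by (simp add: prod_eq_iff fst_sum snd_sum sum_c)
    then have "DM z (x, 0) = DM z (\<Sum>b\<in>B. c b x *\<^sub>R (b, 0))" by (simp only:)
    also have "\<dots> = (\<Sum>b\<in>B. c b x *\<^sub>R DM z (b, 0))"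
      using linear_DM[OF that] by (simp add: linear_sum linear_cmul del: scaleR_Pair)
    finally show ?thesis .
  qed
  have K_sum: "(\<Sum>b\<in>B. c b x *\<^sub>R K (b, 0) v) = K (x, 0) v" for x v
  proof -
    have "((\<lambda>z. \<Sum>b\<in>B. c b x *\<^sub>R DM z (b, 0)) has_derivative (\<lambda>v. \<Sum>b\<in>B. c b x *\<^sub>R K (b, 0) v)) (at (x0, x0))"
      by (intro has_derivative_sum has_derivative_scaleR_right K)
    then have "((\<lambda>z. DM z (x, 0)) has_derivative (\<lambda>v. \<Sum>b\<in>B. c b x *\<^sub>R K (b, 0) v)) (at (x0, x0))"
      by (rule has_derivative_transform_within_open[OF _ M_smooth(1) x0_W]) (simp add: DM_sum)
    from has_derivative_unique[OF this K] show ?thesis by metis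
  qed
  \<comment> \<open>The first partial derivative of \<open>M\<close> at \<open>(p, x0)\<close> is
    the identity for all \<open>p\<close> in the chart, hence constant along the first
    argument.\<close>
  have K1: "K (x, 0) (v, 0) = 0" for x v
  proof -
    have "((\<lambda>p. (p, x0)) has_derivative (\<lambda>v. (v, 0))) (at x0)"
      by (auto intro!: derivative_eq_intros)
    from has_derivative_compose[OF this K]
    have "((\<lambda>p. x) has_derivative (\<lambda>v. K (x, 0) (v, 0))) (at x0)"
      by (rule has_derivative_near[OF _ open_UNIV one_in_chart]) (auto simp: DM_one_right)
    from has_derivative_unique[OF this has_derivative_const] show ?thesis by metis
  qed
  \<comment> \<open>Symmetry of second derivatives swaps the two directions; the vanishing bracket
    then exchanges \<open>velocity\<close> and \<open>w\<close>.\<close>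
  have K2: "K (w, 0) (0, velocity) = K (0, w) (velocity, 0)"
    using frechet_derivative_commute[OF M_smooth(1) M_smooth(2) x0_W, of "(w, 0)" "(0, velocity)"] br[of w]
    by (simp add: K_def)
  have y_minus: "((\<lambda>s. y (- s)) has_derivative (\<lambda>r. - (r *\<^sub>R velocity))) (at 0)"
    using has_derivative_compose[of uminus uminus 0 UNIV y "\<lambda>r. r *\<^sub>R velocity"] curve_has_derivative
    by (simp add: has_derivative_minus has_derivative_ident)
  define u where "u s = DM (y s, x0) (0, w)" for s
  define E where "E b s = DM (y s, y (- s)) (b, 0)" for b s
  have u: "(u has_derivative (\<lambda>r. K (0, w) (r *\<^sub>R velocity, 0))) (at 0)"
    unfolding u_def
    using has_derivative_compose[OF has_derivative_Pair[OF curve_has_derivative has_derivative_const[of x0]], of "\<lambda>z. DM z (0, w)"] K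
    by simp
  have E: "(E b has_derivative (\<lambda>r. K (b, 0) (r *\<^sub>R velocity, - (r *\<^sub>R velocity)))) (at 0)" for b
    unfolding E_def
    using has_derivative_compose[OF has_derivative_Pair[OF curve_has_derivative y_minus], of "\<lambda>z. DM z (b, 0)"] K
    by simp
  have uE0: "u 0 = w" "E b 0 = b" for b by (simp_all add: u_def E_def DM_one)
  have "((\<lambda>s. \<Sum>b\<in>B. c b (u s) *\<^sub>R E b s) has_derivative
      (\<lambda>r. \<Sum>b\<in>B. c b (u 0) *\<^sub>R K (b, 0) (r *\<^sub>R velocity, - (r *\<^sub>R velocity))
        + c b (K (0, w) (r *\<^sub>R velocity, 0)) *\<^sub>R E b 0)) (at 0)"
    by (intro has_derivative_sum has_derivative_scaleR E bounded_linear.has_derivative[OF c_lin u])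
  \<comment> \<open>The moving base point contributes \<open>- r\<close> times
    \<open>K (0, w) (velocity, 0)\<close>, by \<open>K1\<close> and \<open>K2\<close>; the moving
    direction contributes the same with the opposite sign.\<close>
  also have "(\<lambda>r. \<Sum>b\<in>B. c b (u 0) *\<^sub>R K (b, 0) (r *\<^sub>R velocity, - (r *\<^sub>R velocity))
        + c b (K (0, w) (r *\<^sub>R velocity, 0)) *\<^sub>R E b 0) = (\<lambda>_. 0)"
  proof
    fix r
    have 1: "(r *\<^sub>R velocity, - (r *\<^sub>R velocity)) = r *\<^sub>R ((velocity, 0) - (0, velocity))"
      and 2: "(r *\<^sub>R velocity, 0) = r *\<^sub>R (velocity, 0)" by simp_all
    have "K (w, 0) (r *\<^sub>R velocity, - (r *\<^sub>R velocity)) = - (r *\<^sub>R K (0, w) (velocity, 0))"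
      unfolding 1 linear_cmul[OF K_lin] linear_diff[OF K_lin] by (simp add: K1 K2)
    moreover have "K (0, w) (r *\<^sub>R velocity, 0) = r *\<^sub>R K (0, w) (velocity, 0)"
      unfolding 2 by (rule linear_cmul[OF K_lin])
    ultimately show "(\<Sum>b\<in>B. c b (u 0) *\<^sub>R K (b, 0) (r *\<^sub>R velocity, - (r *\<^sub>R velocity))
        + c b (K (0, w) (r *\<^sub>R velocity, 0)) *\<^sub>R E b 0) = 0"
      by (simp add: sum.distrib uE0 K_sum sum_c)
  qed
  finally show ?thesis
  proof (rule has_derivative_transform_within_open[OF _ open_small])
    fix s assume "s \<in> {t. small t}"
    then have "(y s, y (- s)) \<in> W" by (simp add: in_W_iff small_def one_in_chart)
    then show "(\<Sum>b\<in>B. c b (u s) *\<^sub>R E b s) = Ad s w"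
      by (simp add: Ad_def u_def E_def DM_sum)
  qed (simp add: small_zero)
qed

text \<open>Near \<open>s\<close> one has \<open>Ad r = Ad s (Ad (r - s))\<close>, so the derivative
  at \<open>s\<close> is the image under \<open>Ad s\<close> of the vanishing derivative at
  \<open>0\<close>, and \<open>Ad\<close> is constant on the interval.\<close>

lemma Ad_id:
  assumes br: "\<And>w. frechet_derivative (\<lambda>z. DM z (0, w)) (at (x0, x0)) (velocity, 0)
    = frechet_derivative (\<lambda>z. DM z (0, velocity)) (at (x0, x0)) (w, 0)"
    and e: "\<And>t. \<bar>t\<bar> < e \<Longrightarrow> small t" and t: "\<bar>t\<bar> < e"
  shows "Ad t w = w"
proof -
  have "((\<lambda>s. Ad s w) has_derivative (\<lambda>_. 0)) (at s)" if s: "\<bar>s\<bar> < e" for s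
  proof -
    have "((\<lambda>r. Ad s (Ad r w)) has_derivative (\<lambda>_. Ad s 0)) (at (s - s))"
      using bounded_linear.has_derivative[OF has_derivative_bounded_linear[OF Ad_has_derivative[OF e[OF s]]]
          Ad_has_derivative_zero[OF br]] by simp
    moreover have "Ad s 0 = 0"
      using has_derivative_linear[OF Ad_has_derivative[OF e[OF s]]] by (rule linear_0)
    moreover have "((\<lambda>r. r - s) has_derivative (\<lambda>h. h)) (at s)"
      by (auto intro!: derivative_eq_intros)
    ultimately have "((\<lambda>r. Ad s (Ad (r - s) w)) has_derivative (\<lambda>_. 0)) (at s)"
      using has_derivative_compose[of "\<lambda>r. r - s" "\<lambda>h. h" s UNIV "\<lambda>r. Ad s (Ad r w)" "\<lambda>_. 0"] by simp
    then show ?thesis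
    proof (rule has_derivative_transform_within_open)
      show "open ({-e<..<e} \<inter> {s-e<..<s+e})" by auto
      show "Ad s (Ad (r - s) w) = Ad r w" if "r \<in> {-e<..<e} \<inter> {s-e<..<s+e}" for r
        using Ad_add[of s "r - s" w] that e[of r] e[of "r - s"] e[OF s] by (auto simp: abs_less_iff)
    qed (use s in auto)
  qed
  then have "Ad t w = Ad 0 w"
    by (intro has_derivative_zero_unique_connected[of "{-e<..<e}" "\<lambda>s. Ad s w"]) (use t in auto)
  then show ?thesis by (simp add: Ad_zero)
qed

section \<open>Commutators with the curve\<close>

definition comm :: "real \<Rightarrow> 'g \<Rightarrow> 'g" where
  "comm t p = \<gamma> t \<otimes> p \<otimes> \<gamma> (- t) \<otimes> inv p"

lemma continuous_comm: "continuous_on S f \<Longrightarrow> continuous_on S (\<lambda>x. comm t (f x))"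
  unfolding comm_def by (intro continuous_mult continuous_m_inv continuous_on_const)

lemma comm_one [simp]: "comm t \<one> = \<one>"
  by (simp add: comm_def)

text \<open>Expresses the commutator at \<open>q\<close> by the one at
  \<open>inv p \<otimes> q\<close> and fixed translations; this moves a derivative at
  \<open>p\<close> to the identity.\<close>

lemma comm_shift:
  "(\<gamma> t \<otimes> p \<otimes> \<gamma> (- t)) \<otimes> comm t (inv p \<otimes> q) \<otimes> inv p = comm t q"
  by (simp add: comm_def curve_uminus m_assoc inv_mult_group mult_inv_cancel)

text \<open>The commutator is the product of the conjugate and the inverse of \<open>p\<close>, with
  derivatives \<open>w\<close> and \<open>- w\<close>; at the identity the derivative of
  \<open>M\<close> adds them.\<close>

lemma comm_has_derivative_zero_at_one:
  assumes t: "small t" and Ad: "\<And>w. Ad t w = w"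
  shows "((\<lambda>x. \<phi> (comm t (\<psi> x))) has_derivative (\<lambda>_. 0)) (at x0)"
proof -
  have "Ad t = (\<lambda>w. w)" using Ad by auto
  then have C: "((\<lambda>x. \<phi> (\<gamma> t \<otimes> \<psi> x \<otimes> \<gamma> (- t))) has_derivative (\<lambda>w. w)) (at x0)"
    using Ad_has_derivative[OF t] by simp
  have "(M has_derivative DM (x0, x0)) (at (\<phi> (\<gamma> t \<otimes> \<psi> x0 \<otimes> \<gamma> (- t)), \<phi> (inv (\<psi> x0))))"
    using M_deriv[OF x0_W] by (simp add: chart_facts(5) one_in_chart)
  from has_derivative_compose[OF has_derivative_Pair[OF C inverse_has_derivative] this]
  have "((\<lambda>x. M (\<phi> (\<gamma> t \<otimes> \<psi> x \<otimes> \<gamma> (- t)), \<phi> (inv (\<psi> x)))) has_derivative (\<lambda>_. 0)) (at x0)"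
    by (simp add: DM_one)
  moreover have "open ({q. \<gamma> t \<otimes> q \<otimes> \<gamma> (- t) \<in> U} \<inter> {q. inv q \<in> U})"
    by (intro open_Int open_Collect_U continuous_mult continuous_m_inv continuous_on_const continuous_on_id)
  ultimately show ?thesis
    by (rule has_derivative_near) (auto simp: one_in_chart M_phi chart_facts(5) comm_def)
qed

text \<open>By \<open>comm_shift\<close>, near each \<open>p\<close> the map \<open>h\<close>
  factors through its behaviour at the identity, so its derivative vanishes at all points of a ball
  and \<open>h\<close> is constant there.\<close>

lemma commute_near_one:
  assumes t: "small t" and Ad: "\<And>w. Ad t w = w"
  obtains S where "open S" "\<one> \<in> S" "\<And>p. p \<in> S \<Longrightarrow> \<gamma> t \<otimes> p = p \<otimes> \<gamma> t"
proof -
  define h where "h x = \<phi> (comm t (\<psi> x))" for x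
  \<comment> \<open>At \<open>p\<close> in \<open>N\<close> both translating elements
    \<open>inv p\<close> and \<open>a\<close>, as well as
    \<open>a \<otimes> inv p = comm t p\<close>, lie in the chart, as
    \<open>translate_has_derivative\<close> requires.\<close>
  define N where "N = {p. inv p \<in> U} \<inter> {p. \<gamma> t \<otimes> p \<otimes> \<gamma> (- t) \<in> U} \<inter> {p. comm t p \<in> U}"
  have N: "open N" "\<one> \<in> N"
    unfolding N_def
    by (intro open_Int open_Collect_U continuous_mult continuous_m_inv continuous_comm continuous_on_const continuous_on_id)
      (auto simp: one_in_chart)
  have h0: "(h has_derivative (\<lambda>_. 0)) (at x0)"
    unfolding h_def by (rule comm_has_derivative_zero_at_one[OF t Ad])
  have hp: "(h has_derivative (\<lambda>_. 0)) (at (\<phi> p))" if p: "p \<in> U" "p \<in> N" for p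
  proof -
    define a where "a = \<gamma> t \<otimes> p \<otimes> \<gamma> (- t)"
    have pN: "inv p \<in> U" "a \<in> U" "a \<otimes> inv p \<in> U" using p(2) by (auto simp: N_def a_def comm_def)
    obtain T1 where T1: "((\<lambda>x. \<phi> (inv p \<otimes> \<psi> x \<otimes> \<one>)) has_derivative T1) (at (\<phi> p))"
      using translate_has_derivative[of "inv p" \<one> p] p pN one_in_chart by auto
    obtain T2 where T2: "((\<lambda>x. \<phi> (a \<otimes> \<psi> x \<otimes> inv p)) has_derivative T2) (at x0)"
      using translate_has_derivative[of a "inv p" \<one>] pN one_in_chart by auto
    have "((\<lambda>x. h (\<phi> (inv p \<otimes> \<psi> x \<otimes> \<one>))) has_derivative (\<lambda>_. 0)) (at (\<phi> p))"
      using has_derivative_compose[OF T1, of h "\<lambda>_. 0"] h0 p by (simp add: chart_facts(5))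
    moreover have "((\<lambda>x. \<phi> (a \<otimes> \<psi> x \<otimes> inv p)) has_derivative T2) (at (h (\<phi> (inv p \<otimes> \<psi> (\<phi> p) \<otimes> \<one>))))"
      using T2 p by (simp add: chart_facts(5) h_def one_in_chart)
    ultimately have "((\<lambda>x. \<phi> (a \<otimes> \<psi> (h (\<phi> (inv p \<otimes> \<psi> x \<otimes> \<one>))) \<otimes> inv p)) has_derivative (\<lambda>_. T2 0)) (at (\<phi> p))"
      by (rule has_derivative_compose)
    moreover have "T2 0 = 0" using linear_0[OF has_derivative_linear[OF T2]] .
    ultimately have "((\<lambda>x. \<phi> (a \<otimes> \<psi> (h (\<phi> (inv p \<otimes> \<psi> x \<otimes> \<one>))) \<otimes> inv p)) has_derivative (\<lambda>_. 0)) (at (\<phi> p))"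
      by simp
    moreover have "open ({q. inv p \<otimes> q \<in> U} \<inter> {q. comm t (inv p \<otimes> q) \<in> U})"
      by (intro open_Int open_Collect_U continuous_mult continuous_comm continuous_on_const continuous_on_id)
    ultimately show ?thesis
      by (rule has_derivative_near)
        (use p comm_shift[of t p] in \<open>auto simp: one_in_chart chart_facts(5) h_def a_def\<close>)
  qed
  have "open (\<phi> ` (U \<inter> N))" using chart_image_open[OF chart_of_atlas[OF chart] N(1)] .
  then obtain e where e: "e > 0" "ball x0 e \<subseteq> \<phi> ` (U \<inter> N)"
    using N(2) one_in_chart unfolding open_contains_ball by blast
  have const: "h x = x0" if "x \<in> ball x0 e" for x
  proof -
    have "h x = h x0"
    proof (rule has_derivative_zero_unique_connected[of "ball x0 e" h])
      show "(h has_derivative (\<lambda>_. 0)) (at x)" if "x \<in> ball x0 e" for x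
        using that e(2) hp by blast
    qed (use that e in auto)
    then show ?thesis by (simp add: h_def chart_facts(5) one_in_chart)
  qed
  show ?thesis
  proof (rule that)
    have "open (U \<inter> \<phi> -` ball x0 e)"
      using continuous_open_preimage[OF chart_facts(3) chart_facts(1) open_ball] .
    then have "open (U \<inter> \<phi> -` ball x0 e \<inter> N)" using N(1) by (rule open_Int)
    then show "open (U \<inter> N \<inter> \<phi> -` ball x0 e)" by (simp add: Int_ac)
    show "\<one> \<in> U \<inter> N \<inter> \<phi> -` ball x0 e" using N e one_in_chart by simp
    fix p assume p: "p \<in> U \<inter> N \<inter> \<phi> -` ball x0 e"
    then have "\<phi> (comm t p) = \<phi> \<one>" using const[of "\<phi> p"] by (simp add: h_def chart_facts(5))
    \<comment> \<open>\<open>\<phi>\<close> is injective only on \<open>U\<close>, so equality of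
      coordinates gives \<open>comm t p = \<one>\<close> only inside the chart.\<close>
    moreover have "comm t p \<in> U" using p by (simp add: N_def)
    ultimately have "comm t p = \<one>" by (metis chart_facts(5) one_in_chart)
    then have "(\<gamma> t \<otimes> p) \<otimes> inv (p \<otimes> \<gamma> t) = \<one>"
      by (simp add: comm_def curve_uminus m_assoc inv_mult_group)
    then show "\<gamma> t \<otimes> p = p \<otimes> \<gamma> t" by (metis carrier_UNIV inv_equality inv_inv inv_closed)
  qed
qed

text \<open>\<open>\<gamma> 1\<close> is the \<open>Suc n\<close>-fold product of
  \<open>\<gamma> (1 / Suc n)\<close>, whose parameter is below \<open>e\<close> for large
  \<open>n\<close>.\<close>

lemma curve_multiple_induct:
  assumes e: "e > 0" "\<And>t. \<bar>t\<bar> < e \<Longrightarrow> P (\<gamma> t)"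
    and mult: "\<And>p q. \<lbrakk>P p; P q\<rbrakk> \<Longrightarrow> P (p \<otimes> q)"
  shows "P (\<gamma> 1)"
proof -
  obtain n where n: "inverse (real (Suc n)) < e" using reals_Archimedean[OF e(1)] by blast
  have "P (\<gamma> (real k * inverse (real (Suc n))))" for k
  proof (induction k)
    case 0
    then show ?case using e(2)[of 0] e(1) by simp
  next
    case (Suc k)
    have "P (\<gamma> (inverse (real (Suc n))))" using e(2) n by simp
    then have "P (\<gamma> (inverse (real (Suc n))) \<otimes> \<gamma> (real k * inverse (real (Suc n))))"
      using Suc by (intro mult)
    then show ?case by (simp add: curve_add[symmetric] algebra_simps)
  qed
  from this[of "Suc n"] show ?thesis by simp
qed

lemma curve_central:
  assumes conn: "connected (UNIV :: 'g set)"
    and br: "\<And>w f. tangent_bracket G A (D velocity) (D w) f = 0"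
  shows "\<gamma> 1 \<otimes> p = p \<otimes> \<gamma> 1"
proof -
  obtain e where e: "e > 0" "\<And>t. \<bar>t\<bar> < e \<Longrightarrow> small t" using small_nbhd by blast
  have "\<forall>p. \<gamma> t \<otimes> p = p \<otimes> \<gamma> t" if t: "\<bar>t\<bar> < e" for t
  proof -
    have "Ad t w = w" for w
      using Ad_id[OF tangent_bracket_zero_imp[OF br] e(2) t] .
    then obtain S where "open S" "\<one> \<in> S" "\<And>p. p \<in> S \<Longrightarrow> \<gamma> t \<otimes> p = p \<otimes> \<gamma> t"
      using commute_near_one[OF e(2)[OF t]] by metis
    then show ?thesis using commute_all_of_commute_nbhd[OF conn] by metis
  qed
  moreover have "\<forall>r. (p \<otimes> q) \<otimes> r = r \<otimes> (p \<otimes> q)"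
    if "\<forall>r. p \<otimes> r = r \<otimes> p" "\<forall>r. q \<otimes> r = r \<otimes> q" for p q
    using that commute_mult[of _ p q] by (metis carrier_UNIV)
  ultimately have "\<forall>p. \<gamma> 1 \<otimes> p = p \<otimes> \<gamma> 1"
    by (rule curve_multiple_induct[OF e(1), of "\<lambda>c. \<forall>p. c \<otimes> p = p \<otimes> c"])
  then show ?thesis by blast
qed

text \<open>Near \<open>t\<close> the curve is \<open>s\<close> to
  \<open>M (y t, y (s - t))\<close>, so the zero velocity at \<open>0\<close> spreads to all small
  \<open>t\<close>. It identifies the exponential of \<open>0\<close>.\<close>

lemma curve_trivial:
  assumes "velocity = 0"
  shows "\<gamma> 1 = \<one>"
proof -
  obtain e where e: "e > 0" "\<And>t. \<bar>t\<bar> < e \<Longrightarrow> small t" using small_nbhd by blast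
  have der: "(y has_derivative (\<lambda>_. 0)) (at t)" if t: "\<bar>t\<bar> < e" for t
  proof -
    have tU: "\<gamma> t \<in> U" using e(2)[OF t] by (simp add: small_def)
    have "(M has_derivative DM (y t, x0)) (at (y t, y (t - t)))"
      using M_deriv[OF one_W(1)[OF tU]] by simp
    moreover have "((\<lambda>s. y (s - t)) has_derivative (\<lambda>_. 0)) (at t)"
    proof -
      have "((\<lambda>s. s - t) has_derivative (\<lambda>h. h)) (at t)"
        by (auto intro!: derivative_eq_intros)
      from has_derivative_compose[OF this, of y "\<lambda>_. 0"] show ?thesis
        using curve_has_derivative assms by simp
    qed
    ultimately have "((\<lambda>s. M (y t, y (s - t))) has_derivative (\<lambda>_. DM (y t, x0) (0, 0))) (at t)"
      using has_derivative_compose[OF has_derivative_Pair[OF has_derivative_const[of "y t"]]] by blast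
    moreover have "DM (y t, x0) (0, 0) = 0"
      using linear_0[OF linear_DM[OF one_W(1)[OF tU]]] by (simp add: zero_prod_def)
    ultimately have "((\<lambda>s. M (y t, y (s - t))) has_derivative (\<lambda>_. 0)) (at t)" by simp
    then show ?thesis
    proof (rule has_derivative_transform_within_open)
      show "M (y t, y (s - t)) = y s" if "s \<in> {t-e<..<t+e}" for s
      proof -
        have "\<bar>s - t\<bar> < e" using that by auto
        then have "\<gamma> (s - t) \<in> U" using e(2) by (simp add: small_def)
        then show ?thesis using tU curve_add[of t "s - t"] by (simp add: M_phi)
      qed
    qed (use e in auto)
  qed
  have "\<gamma> t = \<one>" if t: "\<bar>t\<bar> < e" for t
  proof -
    have "y t = y 0"
      by (rule has_derivative_zero_unique_connected[of "{-e<..<e}" y]) (use t der e in auto)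
    then show ?thesis using e(2)[OF t] one_in_chart by (metis chart_facts(5) curve_zero small_def)
  qed
  then show ?thesis by (rule curve_multiple_induct[OF e(1), of "\<lambda>p. p = \<one>"]) auto
qed

text \<open>Along the curve \<open>f\<close> is an additive function of a real variable with
  derivative zero at \<open>0\<close>, hence everywhere. It is meant for the components of
  \<open>\<kappa>\<close>.\<close>

lemma additive_function_curve_zero:
  assumes f: "smooth_near A \<one> f" and add: "\<And>p r. f (p \<otimes> r) = f p + f r" and zero: "D velocity f = 0"
  shows "f (\<gamma> 1) = 0"
proof -
  have "((\<lambda>x. f (\<psi> x)) has_derivative (\<lambda>w. D w f)) (at (y 0))"
    using smooth_near_has_derivative[OF atlas f chart one_in_chart] by simp
  from has_derivative_compose[OF curve_has_derivative this]
  have "((\<lambda>t. f (\<psi> (y t))) has_derivative (\<lambda>r. D (r *\<^sub>R velocity) f)) (at 0)" .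
  moreover have "D (r *\<^sub>R velocity) f = 0" for r
    using linear_cmul[OF has_derivative_linear[OF smooth_near_has_derivative[OF atlas f chart one_in_chart]], of r velocity] zero
    by simp
  ultimately have "((\<lambda>t. f (\<psi> (y t))) has_derivative (\<lambda>_. 0)) (at 0)" by simp
  then have der0: "((\<lambda>t. f (\<gamma> t)) has_derivative (\<lambda>_. 0)) (at 0)"
    by (rule has_derivative_transform_within_open[OF _ curve_dom_open]) (auto simp: one_in_chart chart_facts(5))
  have der: "((\<lambda>s. f (\<gamma> s)) has_derivative (\<lambda>_. 0)) (at t)" for t
  proof -
    have "((\<lambda>s. s - t) has_derivative (\<lambda>h. h)) (at t)"
      by (auto intro!: derivative_eq_intros)
    from has_derivative_compose[OF this, of "\<lambda>t. f (\<gamma> t)" "\<lambda>_. 0"] der0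
    have "((\<lambda>s. f (\<gamma> t) + f (\<gamma> (s - t))) has_derivative (\<lambda>_. 0 + 0)) (at t)"
      by (intro has_derivative_add has_derivative_const) simp
    moreover have "f (\<gamma> t) + f (\<gamma> (s - t)) = f (\<gamma> s)" for s
      using curve_add[of t "s - t"] by (simp add: add[symmetric])
    ultimately show ?thesis by simp
  qed
  have "f (\<gamma> 1) = f (\<gamma> 0)"
    by (rule has_derivative_zero_unique_connected[of UNIV "\<lambda>s. f (\<gamma> s)"]) (auto intro: der)
  also have "\<dots> = 0" using add[of \<one> \<one>] by simp
  finally show ?thesis .
qed

end

section \<open>The associated Lie rack\<close>

text \<open>Adding each Leibniz identity to its version with two arguments exchanged cancels the
  outer terms: symmetrized products annihilate, and are annihilated, under multiplication.\<close>

lemma symmetric_leibniz_omega: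
  fixes m :: "'l::real_vector \<Rightarrow> 'l \<Rightarrow> 'l"
  assumes "symmetric_leibniz_algebra m"
  shows "m (leibniz_omega m u v) w = 0" "m w (leibniz_omega m u v) = 0"
    and "leibniz_omega m (m u v) w = 0"
    and "linear (\<lambda>u. leibniz_omega m u w)"
proof -
  have lin: "linear (m u)" "linear (\<lambda>u. m u w)" for u w
    using assms by (auto simp: symmetric_leibniz_algebra_def bilinear_def)
  have L: "m u (m v w) = m (m u v) w + m v (m u w)" for u v w
    using assms unfolding symmetric_leibniz_algebra_def by blast
  have R: "m (m v w) u = m (m v u) w + m v (m w u)" for u v w
    using assms unfolding symmetric_leibniz_algebra_def by blast
  have cancel: "a + b = 0" if "x = a + y" "y = b + x" for a b x y :: 'l
    using that by (metis add.assoc add_cancel_left_left)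
  have L': "m (m u v) w + m (m v u) w = 0" for u v w
    by (rule cancel[OF L L])
  then show "m (leibniz_omega m u v) w = 0"
    by (simp add: leibniz_omega_def linear_cmul[OF lin(2)] linear_add[OF lin(2)])
  have R': "m w (m u v) + m w (m v u) = 0" for u v w
    by (rule cancel[OF R[of w u v, unfolded add.commute[of "m (m w v) u"]] R[of w v u, unfolded add.commute[of "m (m w u) v"]]])
  then show "m w (leibniz_omega m u v) = 0"
    by (simp add: leibniz_omega_def linear_cmul[OF lin(1)] linear_add[OF lin(1)])
  \<comment> \<open>Expanding the first term by the right identity and the second by the left one
    regroups the sum into an instance of \<open>L'\<close> and, up to the order of letters, of
    \<open>R'\<close>.\<close>
  have "m (m u v) w + m w (m u v) = (m (m u w) v + m (m w u) v) + (m u (m v w) + m u (m w v))"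
    unfolding R[of u v w] L[of w u v] by (simp add: add_ac)
  also have "\<dots> = 0" by (simp only: L' R' add_0)
  finally show "leibniz_omega m (m u v) w = 0" by (simp add: leibniz_omega_def)
  show "linear (\<lambda>u. leibniz_omega m u w)"
    unfolding leibniz_omega_def
    by (intro linear_compose_scale_right linear_compose_add lin)
qed

text \<open>The representative of \<open>0\<close> chosen by \<open>inv_into\<close> in
  \<open>leibniz_beta\<close> is only known to lie in the kernel of \<open>q\<close>; this makes
  \<open>\<beta>(0,0)\<close> vanish nevertheless.\<close>

lemma omega_kernel_zero:
  assumes "symmetric_leibniz_algebra m" "product_quotient_map m q" "q n = 0"
  shows "leibniz_omega m n w = 0"
proof -
  have "n \<in> span {m u v | u v. True}" using assms by (auto simp: product_quotient_map_def)
  then show ?thesis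
    by (rule linear_eq_0_on_span[OF symmetric_leibniz_omega(4)[OF assms(1)], rotated])
      (auto simp: symmetric_leibniz_omega(3)[OF assms(1)])
qed

lemma quotient_omega:
  assumes "product_quotient_map m q"
  shows "q (leibniz_omega m u v) = 0"
proof -
  have "leibniz_omega m u v \<in> span {m u v | u v. True}"
    unfolding leibniz_omega_def by (intro span_scale span_add span_base) auto
  then show ?thesis using assms unfolding product_quotient_map_def by blast
qed

theorem mainTheorem2:
  fixes m :: "'l::real_inner \<Rightarrow> 'l \<Rightarrow> 'l"
    and q :: "'l \<Rightarrow> 'a::real_inner"
    and G :: "'g::{t2_space,second_countable_topology} monoid"
    and A :: "('g, 'l) chart set"
    and \<iota> :: "'l \<Rightarrow> ('g \<Rightarrow> real) \<Rightarrow> real"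
    and E :: "'l \<Rightarrow> 'g"
    and \<kappa> :: "'g \<Rightarrow> 'a"
    and chi rop :: "'g \<Rightarrow> 'g \<Rightarrow> 'g"
    and Q :: "'g set"
  assumes "finite_dimensional_UNIV TYPE('l)"
    and "symmetric_leibniz_algebra m"
    and "product_quotient_map m q"
    and "lie_group G A"
    and "connected (UNIV :: 'g set)"
    and "simply_connected (UNIV :: 'g set)"
    and "lie_algebra_identification G A (leibniz_bracket m) \<iota>"
    and "exponential_map G A \<iota> E"
    and "additive_hom_with_differential G A \<iota> q \<kappa>"
  defines "chi \<equiv> lie_rack_chi m q E \<kappa>"
    and "rop \<equiv> lie_rack_op G chi"
    and "Q \<equiv> lie_rack_Q G chi"
  shows "quandle Q rop \<and>
    (quasi_trivial Q rop \<longleftrightarrow>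
      (\<forall>g\<in>Q. \<forall>k\<in>Q. group_commutator G g (inv\<^bsub>G\<^esub> k \<otimes>\<^bsub>G\<^esub> g \<otimes>\<^bsub>G\<^esub> k) = \<one>\<^bsub>G\<^esub>))"
proof -
  note fd = assms(1) and leib = assms(2) and quot = assms(3) and lie = assms(4) and conn = assms(5)
    and ident = assms(7) and exp = assms(8) and hom = assms(9)
  interpret group G using lie by (simp add: lie_group_def)
  have car: "x \<in> carrier G" for x using lie by (simp add: lie_group_def)
  have atlas: "charts_cover A" using lie by (simp add: lie_group_def charts_cover_smooth_atlas)
  obtain U \<phi> where U: "(U, \<phi>) \<in> A" "\<one>\<^bsub>G\<^esub> \<in> U" using charts_coverD(2)[OF atlas] by blast
  interpret lie_group_chart G A U \<phi> by unfold_locales (use lie fd U in auto)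
  define F where "F s t = E (leibniz_beta m q s t)" for s t
  have kappa_mult: "\<kappa> (x \<otimes>\<^bsub>G\<^esub> y) = \<kappa> x + \<kappa> y" for x y
    using hom by (simp add: additive_hom_with_differential_def)
  have kappa_one: "\<kappa> \<one>\<^bsub>G\<^esub> = 0" using kappa_mult[of "\<one>\<^bsub>G\<^esub>" "\<one>\<^bsub>G\<^esub>"] by simp
  have \<iota>0: "\<iota> 0 f = 0" for f
    using ident linear_0 unfolding lie_algebra_identification_def by blast
  have smooth_kappa: "smooth_near A \<one>\<^bsub>G\<^esub> (\<lambda>p. \<kappa> p \<bullet> e)" for e
  proof -
    have "Ck_on k (\<phi>' ` (U' \<inter> UNIV)) (\<lambda>x. \<kappa> (inv_into U' \<phi>' x) \<bullet> e)" if c: "(U', \<phi>') \<in> A" for U' \<phi>' k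
    proof (rule Ck_on_bounded_linear[OF bounded_linear_inner_left chart_image_open[OF chart_of_atlas[OF c] open_UNIV]])
      have "smooth_map_on A vector_atlas UNIV \<kappa>" using hom by (simp add: additive_hom_with_differential_def)
      from smooth_map_on_chart[OF this c, of UNIV id]
      show "Ck_on k (\<phi>' ` (U' \<inter> UNIV)) (\<lambda>x. \<kappa> (inv_into U' \<phi>' x))" by (simp add: vector_atlas_def)
    qed
    then show ?thesis unfolding smooth_near_iff[OF atlas] by (intro exI[of _ UNIV]) auto
  qed
  \<comment> \<open>These are the properties of the twist demanded by \<open>central_twist\<close>,
    proved for every value of \<open>\<omega>\<close>.\<close>
  have omega: "(\<forall>p. E z \<otimes>\<^bsub>G\<^esub> p = p \<otimes>\<^bsub>G\<^esub> E z) \<and> \<kappa> (E z) = 0 \<and> (z = 0 \<longrightarrow> E z = \<one>\<^bsub>G\<^esub>)"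
    if z: "z = leibniz_omega m a b" for z a b
  proof -
    obtain \<gamma> where \<gamma>: "one_parameter_subgroup G A \<gamma>" "differential A \<gamma> 0 (vector_tangent 0 1) = \<iota> z" "E z = \<gamma> 1"
      using exp by (auto simp: exponential_map_def)
    interpret lie_group_curve G A U \<phi> \<gamma> by unfold_locales (rule \<gamma>(1))
    have \<iota>z: "\<iota> z = D velocity" using \<gamma>(2) curve_derivation by simp
    \<comment> \<open>Any \<open>D w\<close> is \<open>\<iota> v\<close> for some \<open>v\<close>;
      since \<open>z\<close> annihilates \<open>v\<close> on both sides, the bracket is
      \<open>\<iota> 0 = 0\<close>.\<close>
    have "tangent_bracket G A (D velocity) (D w) f = 0" for w f
    proof -
      have "D w \<in> tangent_space A \<one>\<^bsub>G\<^esub>" by (rule chart_derivation_in_tangent_space[OF atlas U])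
      then obtain v where v: "\<iota> v = D w"
        using ident unfolding lie_algebra_identification_def bij_betw_def by (metis imageE)
      have "leibniz_bracket m z v = 0"
        by (simp add: z leibniz_bracket_def symmetric_leibniz_omega[OF leib])
      moreover have "\<iota> (leibniz_bracket m z v) = tangent_bracket G A (\<iota> z) (\<iota> v)"
        using ident by (simp add: lie_algebra_identification_def)
      ultimately show ?thesis using \<iota>0[of f] by (simp add: \<iota>z v)
    qed
    then have "\<forall>p. E z \<otimes>\<^bsub>G\<^esub> p = p \<otimes>\<^bsub>G\<^esub> E z" using curve_central[OF conn] by (simp add: \<gamma>(3))
    moreover have "\<kappa> (E z) = 0"
    proof -
      have "\<kappa> (\<gamma> 1) \<bullet> e = 0" for e
      proof (rule additive_function_curve_zero[of "\<lambda>p. \<kappa> p \<bullet> e"])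
        have bl: "bounded_linear (\<lambda>x::'a. x \<bullet> e)" by (rule bounded_linear_inner_left)
        then have near: "smooth_near vector_atlas x (\<lambda>x::'a. x \<bullet> e)" for x
          unfolding smooth_near_vector_atlas_iff using Ck_on_linear[OF _ open_UNIV] by blast
        have "differential vector_atlas \<kappa> \<one>\<^bsub>G\<^esub> (\<iota> z) = vector_tangent 0 (q z)"
          using hom by (simp add: additive_hom_with_differential_def)
        from fun_cong[OF this, of "\<lambda>x. x \<bullet> e"]
        have "\<iota> z (\<lambda>p. \<kappa> p \<bullet> e) = frechet_derivative (\<lambda>x::'a. x \<bullet> e) (at 0) (q z)"
          by (simp add: differential_def vector_tangent_def near o_def)
        \<comment> \<open>\<open>q\<close> kills the products, so the derivative of each component
          of \<open>\<kappa>\<close> along the curve starts at zero.\<close>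
        also have "q z = 0" unfolding z by (rule quotient_omega[OF quot])
        also have "frechet_derivative (\<lambda>x::'a. x \<bullet> e) (at 0) 0 = 0"
          by (intro linear_0 linear_frechet_derivative linear_imp_differentiable bounded_linear_imp_differentiable bl)
        finally show "D velocity (\<lambda>p. \<kappa> p \<bullet> e) = 0" by (simp add: \<iota>z)
      qed (simp_all add: smooth_kappa kappa_mult inner_add_left)
      then show ?thesis unfolding \<gamma>(3) by (metis inner_eq_zero_iff)
    qed
    moreover have "E z = \<one>\<^bsub>G\<^esub>" if "z = 0"
    proof -
      have "velocity \<bullet> e = 0" for e
        using D_coordinate[of velocity e] \<iota>0 that \<iota>z by metis
      then have "velocity = 0" by (metis inner_eq_zero_iff)
      then show ?thesis using curve_trivial by (simp add: \<gamma>(3))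
    qed
    ultimately show ?thesis by blast
  qed
  \<comment> \<open>Whatever representatives are picked, the value lies in the image of
    \<open>\<omega>\<close>, so \<open>omega\<close> applies.\<close>
  have beta: "leibniz_beta m q s t = leibniz_omega m (inv_into UNIV q s) (inv_into UNIV q t)" for s t
    by (rule leibniz_beta_def)
  have beta_zero: "leibniz_beta m q 0 0 = 0"
  proof -
    have "surj q" using quot by (simp add: product_quotient_map_def)
    then have "q (inv_into UNIV q 0) = 0" by (rule surj_f_inv_f)
    then show ?thesis unfolding beta by (rule omega_kernel_zero[OF leib quot])
  qed
  interpret T: central_twist G \<kappa> F
    by unfold_locales (use omega[OF beta] beta_zero in \<open>simp_all add: F_def kappa_mult\<close>)
  have "chi = (\<lambda>h g. F (\<kappa> h) (\<kappa> g))"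
    unfolding chi_def F_def lie_rack_chi_def by (intro ext) simp
  then have "T.op = rop" "T.Q = Q"
    by (simp_all only: T.op_def rop_def T.Q_def Q_def)
  then show ?thesis using T.quandle_Q T.quasi_trivial_iff by simp
qed

end
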